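(* Let $0<\beta<\gamma<1$ and $0\le\mu\le1$. Suppose that $t^{(1-\mu)(1-\beta)}l(t),\ t^{(1-\mu)(1-\beta)}l_{1}(t)\in C(0,+\infty)\cap L^{p}_{Loc}[0,+\infty)$, where $p>1/\beta$, and that there exists a nonnegative constant $K$ such that $t^{\gamma}|l(t)|\le K$ and $t^{\gamma}|l_{1}(t)|\le K$ for all $t\in[1,+\infty)$. Suppose that $t^{1-\beta}k(t),\ t^{1-\beta}k_{1}(t)\in C(0,+\infty)\cap L^{p}_{Loc}[0,+\infty)$ and $\lim_{t\to+\infty}t^{\beta}k(t)=\lim_{t\to+\infty}t^{\beta}k_{1}(t)=b$. Suppose $f:(0,+\infty)\times\mathbb{R}\to\mathbb{R}$ is a continuous function and $$l_{1}(t)x^{\mu}+k_{1}(t)\le f(t,x)\le l(t)x^{\mu}+k(t)\qquad\text{for all }(t,x)\in(0,+\infty)\times\mathbb{R}.$$ Then the Riemann-Liouville fractional differential equation $$D_{0^{+}}^{\beta}x(t)=f(t,x(t)),\quad t\in(0,+\infty),\qquad \lim_{t\to0^{+}}t^{1-\beta}x(t)=x_{0},$$ has at least one solution $x(t)\in C_{1-\beta}(0,+\infty)$ and $$\lim_{t\to+\infty}x(t)=\frac{b\pi}{\Gamma(\beta)\sin(\beta\pi)}.$$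
   Context: Here $l,l_1,k,k_1$ are real-valued functions of $t\in(0,+\infty)$, $x_0$ and $b$ are real constants, and $x^{\mu}$ denotes the $\mu$-th power of $x$. The Riemann-Liouville fractional integral of order $\alpha\in(0,1)$ is $I_{0^{+}}^{\alpha}\rho(t)=\frac{1}{\Gamma(\alpha)}\int_{0}^{t}(t-s)^{\alpha-1}\rho(s)\,ds$. The Riemann-Liouville fractional derivative of order $\beta\in(0,1)$ is $D_{0^{+}}^{\beta}\rho(t)=\frac{d}{dt}I_{0^{+}}^{1-\beta}\rho(t)=\frac{1}{\Gamma(1-\beta)}\frac{d}{dt}\int_{0}^{t}(t-s)^{-\beta}\rho(s)\,ds$, where $I_{0^{+}}^{1-\beta}\rho$ is an absolutely continuous function. $C(0,+\infty)$ is the set of continuous real-valued functions on $(0,+\infty)$. For $\alpha\in(0,1)$, $C_{\alpha}(0,+\infty)$ is the set of $x\in C(0,+\infty)$ such that $t^{\alpha}x(t)$ is (extends to) a continuous function on $[0,+\infty)$. $L^{p}_{Loc}[0,+\infty)$ ($p\ge1$) is the space of all real-valued functions $g$ for which $|g|^{p}$ is Lebesgue integrable over every bounded subinterval of $[0,+\infty)$. A solution is a function satisfying both the differential equation on $(0,+\infty)$ and the initial condition. *)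

theory Defs
  imports "HOL-Analysis.Analysis"
begin

subsection \<open>Real powers of arbitrary real numbers\<close>

text \<open>
  The real function \<open>x\<^sup>\<mu>\<close> is needed on the whole line, where \<open>powr\<close> is not suitable: on the reals,
  \<open>x powr \<mu>\<close> equals \<open>\<bar>x\<bar> powr \<mu>\<close> also for negative \<open>x\<close> (wrong for \<open>\<mu> = 1\<close>), and \<open>0 powr 0 = 0\<close>.
  The predicate below says that \<open>P\<close> is a function \<open>x \<mapsto> x\<^sup>\<mu>\<close>: it is the usual power for positive
  \<open>x\<close>, it is multiplicative, and for a rational exponent \<open>\<mu> = m / n\<close> with odd \<open>n\<close> it is the
  genuine real power, i.e. the \<open>m\<close>-th power of the real \<open>n\<close>-th root (so \<open>P x = 1\<close> for \<open>\<mu> = 0\<close>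
  and \<open>P x = x\<close> for \<open>\<mu> = 1\<close>).  For the remaining exponents negative numbers have no real
  \<open>\<mu>\<close>-th power; there \<open>P\<close> may be either of the usual conventions, \<open>\<bar>x\<bar>\<^sup>\<mu>\<close> or \<open>sgn x * \<bar>x\<bar>\<^sup>\<mu>\<close>.
\<close>

definition real_power_fun :: "real \<Rightarrow> (real \<Rightarrow> real) \<Rightarrow> bool" where
  "real_power_fun \<mu> P \<longleftrightarrow>
     (\<forall>x>0. P x = x powr \<mu>) \<and>
     (\<forall>x y. P (x * y) = P x * P y) \<and>
     (\<forall>m n :: nat. odd n \<longrightarrow> \<mu> = real m / real n \<longrightarrow> (\<forall>x. P x ^ n = x ^ m))"

lemma real_power_fun_0:
  assumes "real_power_fun \<mu> P"
  shows "P 0 = (if \<mu> = 0 then 1 else 0)"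
proof (cases "\<mu> = 0")
  case True
  have "P 0 ^ 1 = 0 ^ 0"
    using assms True unfolding real_power_fun_def
    by (metis odd_one of_nat_0 of_nat_1 div_0)
  with True show ?thesis by simp
next
  case False
  have "P (2 * 0) = P 2 * P 0" "P 2 = 2 powr \<mu>"
    using assms unfolding real_power_fun_def by (blast, simp)
  then have "P 0 * (2 powr \<mu> - 1) = 0" by (simp add: algebra_simps)
  moreover have "2 powr \<mu> \<noteq> (1::real)" using False powr_inj[of 2 \<mu> 0] by simp
  ultimately show ?thesis using False by simp
qed

lemma real_power_fun_abs:
  assumes "real_power_fun \<mu> P" "x \<noteq> 0"
  shows "\<bar>P x\<bar> = \<bar>x\<bar> powr \<mu>"
proof -
  have "P x * P x = P (\<bar>x\<bar> * \<bar>x\<bar>)"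
    using assms(1) unfolding real_power_fun_def by (metis abs_mult_self_eq)
  also have "\<dots> = (\<bar>x\<bar> powr \<mu>) * (\<bar>x\<bar> powr \<mu>)"
  proof -
    have "P (\<bar>x\<bar> * \<bar>x\<bar>) = P \<bar>x\<bar> * P \<bar>x\<bar>" "P \<bar>x\<bar> = \<bar>x\<bar> powr \<mu>"
      using assms unfolding real_power_fun_def by (blast, simp)
    then show ?thesis by simp
  qed
  finally have "(P x)\<^sup>2 = (\<bar>x\<bar> powr \<mu>)\<^sup>2" by (simp add: power2_eq_square)
  then show ?thesis by (metis abs_of_nonneg power2_eq_iff abs_minus_cancel powr_ge_zero)
qed

lemma real_power_fun_exists:
  assumes "\<mu> \<ge> 0"
  shows "\<exists>P. real_power_fun \<mu> P"
proof -
  define s :: real where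
    "s = (if \<exists>m n :: nat. odd m \<and> odd n \<and> \<mu> = real m / real n then -1 else 1)"
  define P where
    "P = (\<lambda>x::real. if x = 0 then (if \<mu> = 0 then 1 else 0) else (if x < 0 then s else 1) * \<bar>x\<bar> powr \<mu>)"
  have ss: "s * s = 1" by (simp add: s_def)
  have s0: "s = 1" if "\<mu> = 0" using that by (auto simp: s_def elim: oddE)
  have "P x = x powr \<mu>" if "x > 0" for x using that by (simp add: P_def)
  moreover have "P (x * y) = P x * P y" for x y
    using ss s0 by (auto simp: P_def abs_mult powr_mult mult_less_0_iff not_less)
  moreover have "P x ^ n = x ^ m" if n: "odd n" and mu: "\<mu> = real m / real n" for m n :: nat and x
  proof (cases "x = 0")
    case True
    have "n > 0" using n by (cases n) auto
    then show ?thesis using True mu by (cases m) (auto simp: P_def)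
  next
    case False
    have n0: "n > 0" using n by (cases n) auto
    have sm: "s = (-1) ^ m"
    proof (cases "even m")
      case True
      have "\<not> (odd m' \<and> odd n' \<and> \<mu> = real m' / real n')" for m' n' :: nat
      proof
        assume a: "odd m' \<and> odd n' \<and> \<mu> = real m' / real n'"
        then have "n' > 0" by (cases n') auto
        with a mu n0 have "real m * real n' = real m' * real n" by (simp add: field_simps)
        then have "m * n' = m' * n" by (metis of_nat_eq_iff of_nat_mult)
        with a n True show False by (metis even_mult_iff)
      qed
      then show ?thesis using True by (auto simp: s_def)
    next
      case False
      then show ?thesis using n mu by (auto simp: s_def)
    qed
    have "(\<bar>x\<bar> powr \<mu>) ^ n = \<bar>x\<bar> powr (\<mu> * real n)"
      using False by (simp add: powr_powr flip: powr_realpow)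
    also have "\<dots> = \<bar>x\<bar> ^ m" using mu n0 False by (simp add: powr_realpow)
    finally have a: "(\<bar>x\<bar> powr \<mu>) ^ n = \<bar>x\<bar> ^ m" .
    have sn: "s ^ n = s" using n by (simp add: s_def)
    show ?thesis
    proof (cases "x < 0")
      case True
      then have "P x ^ n = s ^ n * (\<bar>x\<bar> powr \<mu>) ^ n" by (simp add: P_def power_mult_distrib)
      also have "\<dots> = (-1) ^ m * \<bar>x\<bar> ^ m" unfolding a sn by (simp only: sm)
      also have "\<dots> = x ^ m" using True by (simp flip: power_mult_distrib)
      finally show ?thesis .
    qed (use False a in \<open>simp add: P_def\<close>)
  qed
  ultimately have "real_power_fun \<mu> P" unfolding real_power_fun_def by blast
  then show ?thesis by blast
qed


subsection \<open>Function spaces\<close>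

text \<open>
  Functions on \<open>(0, \<infinity>)\<close> are represented by total functions on the reals whose values outside
  \<open>(0, \<infinity>)\<close> are never relevant.
\<close>

definition Lp_loc :: "real \<Rightarrow> (real \<Rightarrow> real) \<Rightarrow> bool" where
  "Lp_loc p g \<longleftrightarrow>
     set_borel_measurable lebesgue {0..} g \<and>
     (\<forall>a b. 0 \<le> a \<longrightarrow> a \<le> b \<longrightarrow> set_integrable lebesgue {a..b} (\<lambda>t. \<bar>g t\<bar> powr p))"

definition C_weighted :: "real \<Rightarrow> (real \<Rightarrow> real) \<Rightarrow> bool" where
  "C_weighted \<alpha> x \<longleftrightarrow>
     continuous_on {0<..} x \<and>
     (\<exists>g. continuous_on {0..} g \<and> (\<forall>t>0. g t = t powr \<alpha> * x t))"

definition abs_continuous_on :: "real set \<Rightarrow> (real \<Rightarrow> real) \<Rightarrow> bool" where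
  "abs_continuous_on S F \<longleftrightarrow>
     (\<forall>\<epsilon>>0. \<exists>\<delta>>0. \<forall>(n::nat) a b.
        (\<forall>i<n. a i \<le> b i \<and> {a i..b i} \<subseteq> S) \<longrightarrow>
        (\<forall>i<n. \<forall>j<n. i \<noteq> j \<longrightarrow> {a i<..<b i} \<inter> {a j<..<b j} = {}) \<longrightarrow>
        (\<Sum>i<n. b i - a i) < \<delta> \<longrightarrow>
        (\<Sum>i<n. \<bar>F (b i) - F (a i)\<bar>) < \<epsilon>)"


subsection \<open>Riemann-Liouville operators and the initial value problem\<close>

definition RL_integral :: "real \<Rightarrow> (real \<Rightarrow> real) \<Rightarrow> real \<Rightarrow> real" where
  "RL_integral \<alpha> \<rho> t =
     1 / Gamma \<alpha> * (LINT s:{0..t}|lebesgue. (t - s) powr (\<alpha> - 1) * \<rho> s)"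

text \<open>
  The derivative of order \<open>\<beta>\<close> requires the integral of order \<open>1 - \<beta>\<close> to exist (the Lebesgue
  integral is totalised by \<open>0\<close>) and to be absolutely continuous.  The latter is required on every
  \<open>(0, T]\<close>, i.e. up to the extension by continuity to \<open>[0, T]\<close>: the value at \<open>t = 0\<close> must be left
  out, because \<open>RL_integral (1 - \<beta>) \<rho> 0 = 0\<close>, whereas for \<open>\<rho> t = t powr (\<beta> - 1)\<close> the integral is
  a nonzero constant for \<open>t > 0\<close>.
\<close>

definition RL_admissible :: "real \<Rightarrow> (real \<Rightarrow> real) \<Rightarrow> bool" where
  "RL_admissible \<beta> \<rho> \<longleftrightarrow>
     (\<forall>t>0. set_integrable lebesgue {0..t} (\<lambda>s. (t - s) powr (- \<beta>) * \<rho> s)) \<and>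
     (\<forall>T>0. abs_continuous_on {0<..T} (RL_integral (1 - \<beta>) \<rho>))"

definition has_RL_derivative :: "real \<Rightarrow> (real \<Rightarrow> real) \<Rightarrow> real \<Rightarrow> real \<Rightarrow> bool" where
  "has_RL_derivative \<beta> \<rho> D t \<longleftrightarrow>
     RL_admissible \<beta> \<rho> \<and> (RL_integral (1 - \<beta>) \<rho> has_real_derivative D) (at t)"

definition RL_solution ::
    "real \<Rightarrow> (real \<Rightarrow> real \<Rightarrow> real) \<Rightarrow> real \<Rightarrow> (real \<Rightarrow> real) \<Rightarrow> bool" where
  "RL_solution \<beta> f x0 x \<longleftrightarrow>
     (\<forall>t>0. has_RL_derivative \<beta> x (f t (x t)) t) \<and>
     ((\<lambda>t. t powr (1 - \<beta>) * x t) \<longlongrightarrow> x0) (at_right 0)"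

end

theory Submission
  imports Defs "HOL-Complex_Analysis.Great_Picard"
begin

text \<open>
  Put \<open>x t = t powr (\<beta> - 1) * y t\<close>.  Inverting the fractional derivative turns the initial value
  problem into the Volterra equation
  \<open>y t = x0 + t powr (1 - \<beta>) / Gamma \<beta> * (integral over 0 < s < t of (t - s) powr (\<beta> - 1) * f s (x s))\<close>
  for a continuous \<open>y\<close> on the closed half line, so that the singular initial condition becomes
  \<open>y 0 = x0\<close>.  The sandwich condition on \<open>f\<close> implies linear growth,
  \<open>\<bar>f s x\<bar> \<le> h s * (1 + s powr (1 - \<beta>) * \<bar>x\<bar>)\<close>, where \<open>h s\<close> is \<open>s powr (\<beta> - 1)\<close> times a continuous
  function in \<open>L\<^sup>p\<close> near \<open>0\<close>.  The condition \<open>p > 1 / \<beta>\<close> says exactly that the product of the two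
  singularities \<open>(t - s) powr (\<beta> - 1)\<close> and \<open>s powr (\<beta> - 1)\<close> lies in the dual space of \<open>L\<^sup>p\<close>; by
  Young's inequality the Abel integral of \<open>h\<close> is then finite and \<open>o(t powr (\<beta> - 1))\<close> at \<open>0\<close>
  (\<open>abel_Lp_tendsto_0\<close>).  The existence proof uses nothing else about \<open>L\<^sup>p\<close>, and the locale
  \<open>abel_weight\<close> records this interface.

  Existence follows Tonelli.  If the right-hand side sees \<open>y\<close> only with a delay \<open>d > 0\<close>, the equation
  can be solved interval by interval (\<open>delayed_solution_exists\<close>).  The delayed solutions are bounded
  on every \<open>(- \<infinity>, T]\<close> uniformly in \<open>d\<close>: after multiplication by \<open>exp (- c * t)\<close> with \<open>c\<close> large,
  the linear part of the operator has norm at most \<open>1 / 2\<close> (\<open>exp_weighted_abel_small\<close>,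
  \<open>delayed_solutions_bounded\<close>).  They are also equicontinuous at each point
  (\<open>volterra_equicontinuous\<close>), so a subsequence that converges at all rationals converges everywhere,
  and dominated convergence passes to the limit in the equation (\<open>volterra_fixed_point\<close>).

  The semigroup law for Abel integrals, i.e. Fubini and the Beta integral, shows that the fractional
  integral of order \<open>1 - \<beta>\<close> of the resulting \<open>x\<close> is \<open>x0 * Gamma \<beta>\<close> plus the ordinary integral of
  \<open>F s = f s (x s)\<close>.  This gives absolute continuity and the derivative
  (\<open>RL_derivative_of_abel\<close>).

  For the behaviour at infinity, \<open>\<gamma> > \<beta>\<close> makes the coefficients of \<open>x\<close> small compared with
  \<open>s powr (- \<beta>)\<close>, whose Abel integral is the constant \<open>Gamma \<beta> * Gamma (1 - \<beta>)\<close>.  Beyond some time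
  the linear term is therefore a contraction and \<open>x\<close> is bounded on \<open>[1, \<infinity>)\<close>
  (\<open>abel_solution_bounded\<close>).  Boundedness and the sandwich give \<open>t powr \<beta> * F t \<longlonglongrightarrow> b\<close>, and the Abel
  integral of such a function tends to \<open>b * Gamma \<beta> * Gamma (1 - \<beta>)\<close> (\<open>abel_tendsto_at_top\<close>).
  Division by \<open>Gamma \<beta>\<close> and the reflection formula give the limit.
\<close>

section \<open>The Abel kernel\<close>

text \<open>
  The kernel is cut off explicitly outside \<open>[a, t)\<close>, because \<open>powr\<close> takes absolute values of negative
  bases.  A lower limit other than \<open>0\<close> is needed for local estimates and for Fubini.
\<close>
definition abel_kernel :: "real \<Rightarrow> real \<Rightarrow> real \<Rightarrow> real \<Rightarrow> real" where
  "abel_kernel \<beta> a t s = (if a \<le> s \<and> s < t then (t - s) powr (\<beta> - 1) else 0)"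

definition abel_integral :: "real \<Rightarrow> (real \<Rightarrow> real) \<Rightarrow> real \<Rightarrow> real" where
  "abel_integral \<beta> g t = (LINT s|lborel. abel_kernel \<beta> 0 t s * g s)"

lemma abel_kernel_measurable [measurable]: "abel_kernel \<beta> a t \<in> borel_measurable borel"
  unfolding abel_kernel_def by measurable

lemma abel_kernel_nonneg [simp]: "0 \<le> abel_kernel \<beta> a t s"
  by (simp add: abel_kernel_def)

text \<open>
  The affine substitution \<open>s = a + (t - a) * u\<close> reduces this to the Beta integral on \<open>[0, 1]\<close>.
\<close>
lemma has_bochner_integral_Beta:
  fixes x y a t :: real
  assumes "x > 0" "y > 0" "a < t"
  shows "has_bochner_integral lborel (\<lambda>s. abel_kernel y a t s * (s - a) powr (x - 1))
           ((t - a) powr (x + y - 1) * Beta x y)"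
proof -
  define F :: "real \<Rightarrow> real" where
    "F u = indicator {0..1} u * (u powr (x - 1) * (1 - u) powr (y - 1))" for u
  have [measurable]: "F \<in> borel_measurable borel" unfolding F_def by measurable
  have "(\<integral>\<^sup>+u. ennreal (F u) \<partial>lborel) = ennreal (Beta x y)"
    unfolding F_def
    by (rule nn_integral_has_integral_lebesgue[OF _ has_integral_Beta_real]) (use assms in auto)
  then have F: "has_bochner_integral lborel F (Beta x y)"
    using assms by (intro has_bochner_integral_nn_integral)
      (auto simp: F_def Beta_def intro!: divide_nonneg_nonneg mult_nonneg_nonneg less_imp_le[OF Gamma_real_pos])
  define c where "c = 1 / (t - a)"
  have c: "c > 0" using assms by (simp add: c_def)
  have arg: "- a * c + c * s = (s - a) / (t - a)" for s
    by (simp add: c_def diff_divide_distrib)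
  have "has_bochner_integral lborel (\<lambda>s. F (- a * c + c * s)) (Beta x y /\<^sub>R \<bar>c\<bar>)"
    using F c by (subst (asm) lborel_has_bochner_integral_real_affine_iff[of c _ _ "- a * c"]) auto
  then have "has_bochner_integral lborel (\<lambda>s. (t - a) powr (x + y - 2) * F (- a * c + c * s))
      ((t - a) powr (x + y - 2) * (Beta x y /\<^sub>R \<bar>c\<bar>))"
    by (rule has_bochner_integral_mult_right)
  moreover have "(t - a) powr (x + y - 2) * F (- a * c + c * s) = abel_kernel y a t s * (s - a) powr (x - 1)" for s
  proof (cases "a < s \<and> s < t")
    case True
    have "1 - (s - a) / (t - a) = (t - s) / (t - a)"
      using assms by (simp add: field_simps)
    note e = arg[of s] this[folded arg[of s]]
    have p: "(t - a) powr (x + y - 2) = (t - a) powr (x - 1) * (t - a) powr (y - 1)"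
      using assms by (simp flip: powr_add)
    have "- a * c + c * s \<in> {0..1}" unfolding e using True by simp
    then show ?thesis
      using True assms unfolding F_def e(2) unfolding e(1) p abel_kernel_def
      by (simp add: powr_divide)
  next
    case False
    show ?thesis
    proof (cases "s = a \<or> s = t")
      case True then show ?thesis using assms
        unfolding arg by (auto simp: F_def abel_kernel_def)
    next
      case False2: False
      have "- a * c + c * s \<notin> {0..1}"
        unfolding arg using False False2 assms by (auto simp: field_simps)
      then show ?thesis using False False2 by (auto simp: F_def abel_kernel_def)
    qed
  qed
  moreover have "(t - a) powr (x + y - 2) * (Beta x y /\<^sub>R \<bar>c\<bar>) = (t - a) powr (x + y - 1) * Beta x y"
  proof -
    have "(t - a) powr (x + y - 2) * (t - a) = (t - a) powr (x + y - 1)"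
      using assms powr_add[of "t - a" "x + y - 2" 1] by simp
    then show ?thesis using assms by (simp add: c_def)
  qed
  ultimately show ?thesis by (simp only:)
qed

lemma has_bochner_integral_abel_kernel:
  fixes \<beta> a t :: real
  assumes "\<beta> > 0" "a \<le> t"
  shows "has_bochner_integral lborel (abel_kernel \<beta> a t) ((t - a) powr \<beta> / \<beta>)"
proof (cases "a = t")
  case True
  then have "abel_kernel \<beta> a t = (\<lambda>_. 0)" by (auto simp: abel_kernel_def)
  then show ?thesis using True assms by (simp add: has_bochner_integral_zero)
next
  case False
  have "Gamma (\<beta> + 1) = \<beta> * Gamma \<beta>" "Gamma \<beta> > 0"
    using assms by (auto intro!: Gamma_plus1 elim: nonpos_Ints_cases)
  then have "Beta 1 \<beta> = 1 / \<beta>"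
    unfolding Beta_def by (metis Gamma_1 add.commute less_irrefl mult_1 nonzero_divide_mult_cancel_right)
  moreover have "has_bochner_integral lborel (\<lambda>s. abel_kernel \<beta> a t s * (s - a) powr (1 - 1))
           ((t - a) powr (1 + \<beta> - 1) * Beta 1 \<beta>)"
    using assms False by (intro has_bochner_integral_Beta) auto
  ultimately have "has_bochner_integral lborel (\<lambda>s. abel_kernel \<beta> a t s * (s - a) powr (1 - 1))
           ((t - a) powr \<beta> / \<beta>)"
    by simp
  then show ?thesis
    by (rule has_bochner_integralI_AE) (use AE_lborel_singleton[of a] in \<open>auto simp: abel_kernel_def elim!: eventually_mono\<close>)
qed

lemma Gamma_reflection_real:
  assumes "0 < \<beta>" "\<beta> < (1::real)"
  shows "Gamma \<beta> * Gamma (1 - \<beta>) = pi / sin (pi * \<beta>)"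
proof -
  have "complex_of_real (Gamma \<beta> * Gamma (1 - \<beta>)) = complex_of_real (pi / sin (pi * \<beta>))"
    using Gamma_reflection_complex[of "of_real \<beta>"]
    by (metis Gamma_complex_of_real of_real_1 of_real_diff of_real_mult of_real_divide sin_of_real)
  then show ?thesis using of_real_eq_iff by blast
qed

lemma Beta_reflection:
  assumes "0 < \<beta>" "\<beta> < (1::real)"
  shows "Beta \<beta> (1 - \<beta>) = Gamma \<beta> * Gamma (1 - \<beta>)" "Beta (1 - \<beta>) \<beta> = Gamma \<beta> * Gamma (1 - \<beta>)"
  by (simp_all add: Beta_def)

section \<open>Weights that the Abel kernel tolerates\<close>

lemma borel_measurable_continuous_pos:
  fixes g :: "real \<Rightarrow> real"
  assumes "continuous_on {0<..} g" "\<And>s. s \<le> 0 \<Longrightarrow> g s = 0"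
  shows "g \<in> borel_measurable borel"
proof -
  have "(\<lambda>s. indicator {0<..} s *\<^sub>R g s) \<in> borel_measurable borel"
    using assms(1) by (intro borel_measurable_continuous_on_indicator) auto
  also have "(\<lambda>s. indicator {0<..} s *\<^sub>R g s) = g"
    using assms(2) by (auto simp: indicator_def fun_eq_iff not_less)
  finally show ?thesis .
qed

text \<open>
  Away from its singularity the kernel is Lipschitz in \<open>t\<close>: for \<open>s \<le> a\<close> and \<open>t \<ge> 2 * a\<close> the base
  \<open>t - s\<close> stays above \<open>a\<close>, and the mean value theorem applies.
\<close>
lemma abel_kernel_increment_bound:
  fixes \<beta> a t0 t s :: real
  assumes "0 < \<beta>" "\<beta> < 1" "0 < a" "2 * a \<le> t0" "t0 \<le> t" "0 \<le> s" "s \<le> a"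
  shows "\<bar>abel_kernel \<beta> 0 t s - abel_kernel \<beta> 0 t0 s\<bar> \<le> (1 - \<beta>) * a powr (\<beta> - 2) * (t - t0)"
proof (cases "t0 = t")
  case False
  have "\<exists>z. t0 - s < z \<and> z < t - s \<and>
     (t - s) powr (\<beta> - 1) - (t0 - s) powr (\<beta> - 1) = ((t - s) - (t0 - s)) * ((\<beta> - 1) * z powr (\<beta> - 1 - 1))"
    using assms False by (intro MVT2) (auto intro!: derivative_eq_intros simp: has_field_derivative_powr)
  then obtain z where z: "t0 - s < z"
    "(t - s) powr (\<beta> - 1) - (t0 - s) powr (\<beta> - 1) = (t - t0) * ((\<beta> - 1) * z powr (\<beta> - 2))"
    by auto
  have "z powr (\<beta> - 2) \<le> a powr (\<beta> - 2)"
    using z(1) assms by (intro powr_mono2') auto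
  moreover have "\<bar>(t - t0) * ((\<beta> - 1) * z powr (\<beta> - 2))\<bar> = (1 - \<beta>) * z powr (\<beta> - 2) * (t - t0)"
    using assms by (simp add: abs_mult)
  moreover have "\<dots> \<le> (1 - \<beta>) * a powr (\<beta> - 2) * (t - t0)" if "z powr (\<beta> - 2) \<le> a powr (\<beta> - 2)"
    using assms that by (intro mult_right_mono mult_left_mono) auto
  ultimately show ?thesis using assms z(2) by (simp add: abel_kernel_def)
qed simp

text \<open>
  On \<open>[0, T]\<close> the kernel with end point \<open>T + 1\<close> is bounded below by the positive constant
  \<open>(T + 1) powr (\<beta> - 1)\<close>.
\<close>
lemma integrable_of_abel_kernel:
  assumes beta: "0 < \<beta>" "\<beta> < 1" and [measurable]: "g \<in> borel_measurable borel"
    and int: "integrable lborel (\<lambda>s. abel_kernel \<beta> 0 (T + 1) s * g s)" and T: "0 \<le> T"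
  shows "integrable lborel (\<lambda>s. indicator {0..T} s * g s)"
proof (rule Bochner_Integration.integrable_bound)
  show "integrable lborel (\<lambda>s. (T + 1) powr (1 - \<beta>) * (abel_kernel \<beta> 0 (T + 1) s * g s))"
    using int by (rule integrable_mult_right)
  have "\<bar>indicator {0..T} s * g s\<bar> \<le> \<bar>(T + 1) powr (1 - \<beta>) * (abel_kernel \<beta> 0 (T + 1) s * g s)\<bar>" for s
  proof (cases "s \<in> {0..T}")
    case s: True
    have "(T + 1) powr (\<beta> - 1) \<le> (T + 1 - s) powr (\<beta> - 1)"
      using beta s by (intro powr_mono2') auto
    then have "(T + 1) powr (1 - \<beta>) * (T + 1) powr (\<beta> - 1) * \<bar>g s\<bar> \<le> (T + 1) powr (1 - \<beta>) * (T + 1 - s) powr (\<beta> - 1) * \<bar>g s\<bar>"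
      by (intro mult_right_mono mult_left_mono) auto
    then show ?thesis using s T by (simp add: abel_kernel_def abs_mult mult.assoc flip: powr_add)
  qed auto
  then show "AE s in lborel. norm (indicator {0..T} s * g s) \<le> norm ((T + 1) powr (1 - \<beta>) * (abel_kernel \<beta> 0 (T + 1) s * g s))"
    by simp
qed measurable

lemma exp_minus_le_powr:
  fixes u r :: real
  assumes "0 < u" "0 \<le> r" "r \<le> 1"
  shows "exp (- u) \<le> u powr (- r)"
proof -
  have "u powr r \<le> exp u"
  proof (cases "u \<le> 1")
    case True
    then have "u powr r \<le> 1" using assms by (intro powr_le1) auto
    also have "1 \<le> exp u" using assms by simp
    finally show ?thesis .
  next
    case False
    then have "u powr r \<le> u powr 1" using assms by (intro powr_mono) auto
    also have "\<dots> \<le> exp u" using assms exp_ge_add_one_self[of u] by (simp del: exp_ge_add_one_self)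
    finally show ?thesis .
  qed
  then have "inverse (exp u) \<le> inverse (u powr r)" using assms by (intro le_imp_inverse_le) auto
  then show ?thesis by (simp add: exp_minus powr_minus)
qed

text \<open>
  A weight \<open>h\<close> bounds right-hand sides that may be singular at \<open>0\<close>.  The last assumption makes the
  Volterra operator continuous at \<open>t = 0\<close>; away from \<open>0\<close>, continuity of \<open>h\<close> provides local bounds.
  Setting \<open>h\<close> to \<open>0\<close> on \<open>s \<le> 0\<close> makes it Borel measurable on the whole line.
\<close>
locale abel_weight =
  fixes \<beta> :: real and h :: "real \<Rightarrow> real"
  assumes beta: "0 < \<beta>" "\<beta> < 1"
    and h_cont: "continuous_on {0<..} h"
    and h_nonneg: "\<And>s. 0 \<le> h s"
    and h_zero: "\<And>s. s \<le> 0 \<Longrightarrow> h s = 0"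
    and h_int: "\<And>t. 0 < t \<Longrightarrow> integrable lborel (\<lambda>s. abel_kernel \<beta> 0 t s * h s)"
    and h_small: "((\<lambda>t. t powr (1 - \<beta>) * abel_integral \<beta> h t) \<longlongrightarrow> 0) (at_right 0)"
begin

lemma h_measurable [measurable]: "h \<in> borel_measurable borel"
  using borel_measurable_continuous_pos[OF h_cont h_zero] .

lemma h_locally_integrable: "integrable lborel (\<lambda>s. indicator {0..T} s * h s)"
proof (cases "0 \<le> T")
  case True
  then show ?thesis
    by (intro integrable_of_abel_kernel[OF beta] h_int) auto
next
  case False
  then have "(\<lambda>s. indicator {0..T} s * h s) = (\<lambda>_. 0)"
    by (auto simp: indicator_def fun_eq_iff)
  then show ?thesis by simp
qed

lemma abel_integrable:
  assumes [measurable]: "g \<in> borel_measurable borel" and "\<And>s. 0 \<le> s \<Longrightarrow> s < t \<Longrightarrow> \<bar>g s\<bar> \<le> C * h s"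
  shows "integrable lborel (\<lambda>s. abel_kernel \<beta> 0 t s * g s)"
proof (cases "t > 0")
  case True
  show ?thesis
  proof (rule Bochner_Integration.integrable_bound)
    show "integrable lborel (\<lambda>s. C * (abel_kernel \<beta> 0 t s * h s))"
      using True by (intro integrable_mult_right h_int)
    have "\<bar>abel_kernel \<beta> 0 t s * g s\<bar> \<le> C * (abel_kernel \<beta> 0 t s * h s)" for s
    proof (cases "0 \<le> s \<and> s < t")
      case True
      then have "abel_kernel \<beta> 0 t s * \<bar>g s\<bar> \<le> abel_kernel \<beta> 0 t s * (C * h s)"
        using assms(2) by (intro mult_left_mono) auto
      then show ?thesis by (simp add: abs_mult mult_ac)
    qed (auto simp: abel_kernel_def)
    then show "AE s in lborel. norm (abel_kernel \<beta> 0 t s * g s) \<le> norm (C * (abel_kernel \<beta> 0 t s * h s))"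
      by (intro always_eventually allI) (smt (verit) real_norm_def)
  qed measurable
next
  case False
  then have "(\<lambda>s. abel_kernel \<beta> 0 t s * g s) = (\<lambda>_. 0)" by (auto simp: abel_kernel_def fun_eq_iff)
  then show ?thesis by simp
qed

lemma abel_abs_le:
  assumes [measurable]: "g \<in> borel_measurable borel" and "\<And>s. 0 \<le> s \<Longrightarrow> s < t \<Longrightarrow> \<bar>g s\<bar> \<le> C * h s"
  shows "\<bar>abel_integral \<beta> g t\<bar> \<le> C * abel_integral \<beta> h t"
proof -
  have i: "integrable lborel (\<lambda>s. abel_kernel \<beta> 0 t s * (C * h s))"
    using assms(2) by (intro abel_integrable[where C = "\<bar>C\<bar>"]) (auto simp: abs_mult h_nonneg)
  have "\<bar>abel_integral \<beta> g t\<bar> \<le> (LINT s|lborel. abel_kernel \<beta> 0 t s * (C * h s))"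
    unfolding abel_integral_def
  proof (rule integral_abs_bound_integral[OF abel_integrable[OF assms] i])
    fix s
    show "\<bar>abel_kernel \<beta> 0 t s * g s\<bar> \<le> abel_kernel \<beta> 0 t s * (C * h s)"
      using assms(2)[of s] by (auto simp: abel_kernel_def abs_mult intro!: mult_left_mono)
  qed
  also have "\<dots> = C * abel_integral \<beta> h t"
    by (simp add: abel_integral_def mult.left_commute)
  finally show ?thesis .
qed

text \<open>
  A modulus of continuity for Abel integrals on \<open>[2 * a, t]\<close> that is uniform over all integrands
  dominated by \<open>C * h\<close>.  On \<open>[0, a]\<close> the kernel is Lipschitz in \<open>t\<close> and \<open>h\<close> is merely integrable; on
  \<open>[a, t]\<close> the function \<open>h\<close> is bounded by \<open>M\<close>, and since the kernel decreases in \<open>t\<close>, the integral of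
  \<open>\<bar>kernel t - kernel t0\<bar>\<close> can be computed without the absolute value, up to the new piece \<open>[t0, t]\<close>.
\<close>
lemma abel_increment:
  assumes [measurable]: "g \<in> borel_measurable borel" and g: "\<And>s. 0 \<le> s \<Longrightarrow> s < t \<Longrightarrow> \<bar>g s\<bar> \<le> C * h s"
    and a: "0 < a" "2 * a \<le> t0" "t0 \<le> t" and M: "\<And>s. a \<le> s \<Longrightarrow> s \<le> t \<Longrightarrow> h s \<le> M" and C: "0 \<le> C"
  shows "\<bar>abel_integral \<beta> g t - abel_integral \<beta> g t0\<bar> \<le>
    C * ((1 - \<beta>) * a powr (\<beta> - 2) * (LINT s|lborel. indicator {0..a} s * h s) * (t - t0) + 2 * M / \<beta> * (t - t0) powr \<beta>)"
proof -
  define c where "c = (1 - \<beta>) * a powr (\<beta> - 2) * (t - t0)"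
  have c: "0 \<le> c" using beta a by (simp add: c_def)
  have M0: "0 \<le> M" using M[of a] h_nonneg[of a] a by linarith
  \<comment> \<open>The factor 2 is there because the piece \<open>[t0, t)\<close> enters \<open>- abel_kernel \<beta> a t\<close> with the wrong sign.\<close>
  define R where "R s = C * (c * (indicator {0..a} s * h s)
     + M * (abel_kernel \<beta> a t0 s - abel_kernel \<beta> a t s + 2 * abel_kernel \<beta> t0 t s))" for s
  have kint: "has_bochner_integral lborel (abel_kernel \<beta> u v) ((v - u) powr \<beta> / \<beta>)" if "u \<le> v" for u v
    using has_bochner_integral_abel_kernel beta that by blast
  have R: "has_bochner_integral lborel R (C * (c * (LINT s|lborel. indicator {0..a} s * h s)
     + M * ((t0 - a) powr \<beta> / \<beta> - (t - a) powr \<beta> / \<beta> + 2 * ((t - t0) powr \<beta> / \<beta>))))"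
    unfolding R_def using a
    by (intro has_bochner_integral_add has_bochner_integral_diff has_bochner_integral_mult_right kint
        has_bochner_integral_integrable h_locally_integrable) auto
  have i: "integrable lborel (\<lambda>s. abel_kernel \<beta> 0 u s * g s)" if "u \<le> t" for u
    using that by (intro abel_integrable[where C = C] g) auto
  have pw: "\<bar>abel_kernel \<beta> 0 t s * g s - abel_kernel \<beta> 0 t0 s * g s\<bar> \<le> R s" for s
  proof -
    have lhs: "\<bar>abel_kernel \<beta> 0 t s * g s - abel_kernel \<beta> 0 t0 s * g s\<bar> = \<bar>abel_kernel \<beta> 0 t s - abel_kernel \<beta> 0 t0 s\<bar> * \<bar>g s\<bar>"
      by (simp add: abs_mult flip: left_diff_distrib)
    have nn: "0 \<le> abel_kernel \<beta> a t0 s - abel_kernel \<beta> a t s + 2 * abel_kernel \<beta> t0 t s"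
    proof (cases "a \<le> s \<and> s < t0")
      case True
      then have "(t - s) powr (\<beta> - 1) \<le> (t0 - s) powr (\<beta> - 1)"
        using beta a by (intro powr_mono2') auto
      then show ?thesis using True a by (simp add: abel_kernel_def)
    qed (use a in \<open>auto simp: abel_kernel_def\<close>)
    consider "s < 0 \<or> s \<ge> t" | "0 \<le> s" "s < a" | "a \<le> s" "s < t" by linarith
    then show ?thesis
    proof cases
      case 1
      then have "\<bar>abel_kernel \<beta> 0 t s * g s - abel_kernel \<beta> 0 t0 s * g s\<bar> = 0"
        using a by (auto simp: abel_kernel_def)
      also have "0 \<le> R s" unfolding R_def using c C h_nonneg mult_nonneg_nonneg[OF M0 nn]
        by (intro mult_nonneg_nonneg[OF C] add_nonneg_nonneg) auto
      finally show ?thesis .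
    next
      case 2
      have "\<bar>abel_kernel \<beta> 0 t s * g s - abel_kernel \<beta> 0 t0 s * g s\<bar> \<le> c * (C * h s)"
        unfolding lhs c_def using 2 a beta g[of s] by (intro mult_mono abel_kernel_increment_bound) auto
      also have "\<dots> \<le> R s"
      proof -
        have "C * (M * (abel_kernel \<beta> a t0 s - abel_kernel \<beta> a t s + 2 * abel_kernel \<beta> t0 t s)) \<ge> 0"
          using nn C M0 by (intro mult_nonneg_nonneg) auto
        then show ?thesis using 2 by (simp add: R_def algebra_simps)
      qed
      finally show ?thesis .
    next
      case 3
      have "\<bar>abel_kernel \<beta> 0 t s - abel_kernel \<beta> 0 t0 s\<bar> \<le> abel_kernel \<beta> a t0 s - abel_kernel \<beta> a t s + 2 * abel_kernel \<beta> t0 t s"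
      proof (cases "s < t0")
        case True
        then have "(t - s) powr (\<beta> - 1) \<le> (t0 - s) powr (\<beta> - 1)"
          using beta a by (intro powr_mono2') auto
        then show ?thesis using True 3 a by (simp add: abel_kernel_def)
      qed (use a 3 in \<open>auto simp: abel_kernel_def\<close>)
      moreover have "\<bar>g s\<bar> \<le> C * M"
        using g[of s] M[of s] 3 a C mult_left_mono[of "h s" M C] by force
      ultimately have "\<bar>abel_kernel \<beta> 0 t s * g s - abel_kernel \<beta> 0 t0 s * g s\<bar>
          \<le> (abel_kernel \<beta> a t0 s - abel_kernel \<beta> a t s + 2 * abel_kernel \<beta> t0 t s) * (C * M)"
        unfolding lhs using nn by (intro mult_mono) auto
      also have "\<dots> \<le> R s"
      proof -
        have "C * (c * (indicator {0..a} s * h s)) \<ge> 0"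
          using C c h_nonneg by (intro mult_nonneg_nonneg) auto
        then show ?thesis by (simp add: R_def algebra_simps)
      qed
      finally show ?thesis .
    qed
  qed
  have "\<bar>abel_integral \<beta> g t - abel_integral \<beta> g t0\<bar> = \<bar>LINT s|lborel. abel_kernel \<beta> 0 t s * g s - abel_kernel \<beta> 0 t0 s * g s\<bar>"
    unfolding abel_integral_def using i a by simp
  also have "\<dots> \<le> (LINT s|lborel. \<bar>abel_kernel \<beta> 0 t s * g s - abel_kernel \<beta> 0 t0 s * g s\<bar>)"
    by (rule integral_abs_bound)
  also have "\<dots> \<le> (LINT s|lborel. R s)"
    using pw i a by (intro integral_mono integrable.intros[OF R] integrable_abs Bochner_Integration.integrable_diff) auto
  also have "\<dots> = C * (c * (LINT s|lborel. indicator {0..a} s * h s)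
     + M * ((t0 - a) powr \<beta> / \<beta> - (t - a) powr \<beta> / \<beta> + 2 * ((t - t0) powr \<beta> / \<beta>)))"
    by (rule has_bochner_integral_integral_eq[OF R])
  also have "\<dots> \<le> C * (c * (LINT s|lborel. indicator {0..a} s * h s) + M * (2 * ((t - t0) powr \<beta> / \<beta>)))"
  proof -
    have "(t0 - a) powr \<beta> \<le> (t - a) powr \<beta>" using a beta by (intro powr_mono2) auto
    then have "(t0 - a) powr \<beta> / \<beta> - (t - a) powr \<beta> / \<beta> \<le> 0" using beta by (simp add: divide_right_mono)
    then show ?thesis using C M0 by (intro mult_left_mono add_left_mono) auto
  qed
  finally show ?thesis by (simp add: c_def mult_ac)
qed

lemma h_bounded_away_from_0:
  assumes "0 < a"
  obtains M where "0 \<le> M" "\<And>s. a \<le> s \<Longrightarrow> s \<le> b \<Longrightarrow> h s \<le> M"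
proof -
  have "compact (h ` {a..b})"
    using assms by (intro compact_continuous_image continuous_on_subset[OF h_cont]) auto
  then obtain M where "\<And>s. s \<in> {a..b} \<Longrightarrow> norm (h s) \<le> M"
    using bounded_iff compact_imp_bounded by (metis image_eqI)
  then show ?thesis using that[of "max 0 M"] by force
qed

text \<open>
  The exponential weight makes the memory short.  For small \<open>t\<close> the bound is the smallness of the
  weight at \<open>0\<close>.  For \<open>t\<close> bounded away from \<open>0\<close>, the factor \<open>exp (- c * a)\<close> kills the part \<open>s < a\<close>
  with the singularity of \<open>h\<close>, and near \<open>s = t\<close> a half of the available exponent is traded for decay
  in \<open>c\<close> through \<open>exp (- u) \<le> u powr (- \<beta> / 2)\<close>.
\<close>
lemma exp_weighted_abel_small:
  assumes "0 < T" "0 < \<epsilon>"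
  obtains c where "0 < c"
    "\<And>t. 0 < t \<Longrightarrow> t \<le> T \<Longrightarrow> t powr (1 - \<beta>) * abel_integral \<beta> (\<lambda>s. exp (- c * (t - s)) * h s) t \<le> \<epsilon>"
proof -
  have "eventually (\<lambda>t. t powr (1 - \<beta>) * abel_integral \<beta> h t < \<epsilon>) (at_right 0)"
    using order_tendstoD(2)[OF h_small assms(2)] .
  then obtain \<delta> where \<delta>: "\<delta> > 0" "\<And>t. 0 < t \<Longrightarrow> t < \<delta> \<Longrightarrow> t powr (1 - \<beta>) * abel_integral \<beta> h t < \<epsilon>"
    unfolding eventually_at_right_field by auto
  define a where "a = \<delta> / 2"
  have a: "0 < a" using \<delta> by (simp add: a_def)
  obtain M where M: "0 \<le> M" "\<And>s. a \<le> s \<Longrightarrow> s \<le> T \<Longrightarrow> h s \<le> M"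
    using h_bounded_away_from_0[OF a] by metis
  define A where "A = (LINT s|lborel. indicator {0..T} s * h s)"
  define G where "G c = T powr (1 - \<beta>) *
      (a powr (\<beta> - 1) * exp (- c * a) * A + M * c powr (- (\<beta> / 2)) * (T powr (\<beta> / 2) / (\<beta> / 2)))" for c
  have "(G \<longlongrightarrow> T powr (1 - \<beta>) *
      (a powr (\<beta> - 1) * 0 * A + M * 0 * (T powr (\<beta> / 2) / (\<beta> / 2)))) at_top"
    unfolding G_def
  proof (intro tendsto_intros)
    have "filterlim (\<lambda>c. - (c * a)) at_bot at_top"
      using a by (simp add: filterlim_uminus_at_bot filterlim_at_top_mult_tendsto_pos[OF tendsto_const _ filterlim_ident])
    then show "((\<lambda>c. exp (- c * a)) \<longlongrightarrow> 0) at_top"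
      using filterlim_compose[OF exp_at_bot] by simp
    show "((\<lambda>c. c powr (- (\<beta> / 2))) \<longlongrightarrow> 0) at_top"
      using beta by (intro tendsto_neg_powr filterlim_ident) auto
  qed
  then have "eventually (\<lambda>c. G c < \<epsilon>) at_top" using assms by (intro order_tendstoD) auto
  then have "eventually (\<lambda>c. G c < \<epsilon> \<and> c > 0) at_top"
    by (intro eventually_conj eventually_gt_at_top)
  then obtain c where c: "G c < \<epsilon>" "c > 0" 
    using eventually_happens'[OF trivial_limit_at_top_linorder] by auto
  have ei: "integrable lborel (\<lambda>s. abel_kernel \<beta> 0 t s * (exp (- c * (t - s)) * h s))" for t
    using c h_nonneg by (intro abel_integrable[where C = 1]) (auto simp: abs_mult mult_left_le_one_le)
  have "t powr (1 - \<beta>) * abel_integral \<beta> (\<lambda>s. exp (- c * (t - s)) * h s) t \<le> \<epsilon>" if t: "0 < t" "t \<le> T" for t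
  proof (cases "t < \<delta>")
    case True
    have "abel_integral \<beta> (\<lambda>s. exp (- c * (t - s)) * h s) t \<le> abel_integral \<beta> h t"
      unfolding abel_integral_def
    proof (rule integral_mono[OF ei h_int[OF t(1)]])
      fix s
      show "abel_kernel \<beta> 0 t s * (exp (- c * (t - s)) * h s) \<le> abel_kernel \<beta> 0 t s * h s"
        using c h_nonneg by (auto simp: abel_kernel_def intro!: mult_left_mono mult_left_le_one_le)
    qed
    then have "t powr (1 - \<beta>) * abel_integral \<beta> (\<lambda>s. exp (- c * (t - s)) * h s) t \<le> t powr (1 - \<beta>) * abel_integral \<beta> h t"
      by (intro mult_left_mono) auto
    then show ?thesis using \<delta>(2)[OF t(1) True] by linarith
  next
    case False
    define R where "R s = a powr (\<beta> - 1) * exp (- c * a) * (indicator {0..T} s * h s)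
       + M * c powr (- (\<beta> / 2)) * abel_kernel (\<beta> / 2) 0 t s" for s
    have R: "has_bochner_integral lborel R (a powr (\<beta> - 1) * exp (- c * a) * A
        + M * c powr (- (\<beta> / 2)) * ((t - 0) powr (\<beta> / 2) / (\<beta> / 2)))"
      unfolding R_def A_def using beta t
      by (intro has_bochner_integral_add has_bochner_integral_mult_right has_bochner_integral_abel_kernel
          has_bochner_integral_integrable h_locally_integrable) auto
    have pw: "abel_kernel \<beta> 0 t s * (exp (- c * (t - s)) * h s) \<le> R s" for s
    proof -
      have nn: "0 \<le> a powr (\<beta> - 1) * exp (- c * a) * (indicator {0..T} s * h s)"
        "0 \<le> M * c powr (- (\<beta> / 2)) * abel_kernel (\<beta> / 2) 0 t s"
        using M h_nonneg by auto
      consider "s < 0 \<or> s \<ge> t" | "0 \<le> s" "s < a" | "a \<le> s" "s < t" by linarith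
      then show ?thesis
      proof cases
        case 1
        then have "abel_kernel \<beta> 0 t s = 0" by (auto simp: abel_kernel_def)
        then show ?thesis using nn by (simp add: R_def)
      next
        case 2
        then have st: "t - s \<ge> a" using False by (simp add: a_def)
        have "abel_kernel \<beta> 0 t s * (exp (- c * (t - s)) * h s) \<le> a powr (\<beta> - 1) * (exp (- c * a) * h s)"
          using 2 st a beta c h_nonneg
          by (intro mult_mono) (auto simp: abel_kernel_def intro!: powr_mono2')
        then show ?thesis using 2 nn(2) st t a by (simp add: R_def)
      next
        case 3
        have "exp (- c * (t - s)) \<le> (c * (t - s)) powr (- (\<beta> / 2))"
          using exp_minus_le_powr[of "c * (t - s)" "\<beta> / 2"] 3 c beta by simp
        then have "abel_kernel \<beta> 0 t s * (exp (- c * (t - s)) * h s) \<le>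
           (t - s) powr (\<beta> - 1) * ((c * (t - s)) powr (- (\<beta> / 2)) * M)"
          using 3 a t M h_nonneg
          by (intro mult_mono) (auto simp: abel_kernel_def)
        also have "\<dots> = M * c powr (- (\<beta> / 2)) * ((t - s) powr (\<beta> - 1) * (t - s) powr (- (\<beta> / 2)))"
          using 3 c by (simp add: powr_mult)
        also have "(t - s) powr (\<beta> - 1) * (t - s) powr (- (\<beta> / 2)) = abel_kernel (\<beta> / 2) 0 t s"
          using 3 a by (simp add: abel_kernel_def flip: powr_add)
        finally show ?thesis using nn(1) by (simp add: R_def)
      qed
    qed
    have "abel_integral \<beta> (\<lambda>s. exp (- c * (t - s)) * h s) t \<le> a powr (\<beta> - 1) * exp (- c * a) * A
        + M * c powr (- (\<beta> / 2)) * ((t - 0) powr (\<beta> / 2) / (\<beta> / 2))"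
      unfolding abel_integral_def has_bochner_integral_integral_eq[OF R, symmetric]
      by (intro integral_mono ei pw integrable.intros[OF R])
    also have "\<dots> \<le> a powr (\<beta> - 1) * exp (- c * a) * A
        + M * c powr (- (\<beta> / 2)) * (T powr (\<beta> / 2) / (\<beta> / 2))"
      using t M beta by (intro add_left_mono mult_left_mono divide_right_mono powr_mono2) auto
    finally have "t powr (1 - \<beta>) * abel_integral \<beta> (\<lambda>s. exp (- c * (t - s)) * h s) t \<le> G c"
      unfolding G_def using t beta h_nonneg
      by (intro mult_mono powr_mono2) (auto simp: abel_integral_def intro!: Bochner_Integration.integral_nonneg)
    then show ?thesis using c by simp
  qed
  with c that show ?thesis by blast
qed

text \<open>
  On \<open>[0, T]\<close> the exponential weight is bounded below by \<open>exp (- c * T)\<close>, so it can be removed.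
\<close>
lemma abel_h_bounded:
  obtains B where "0 \<le> B" "\<And>t. 0 < t \<Longrightarrow> t \<le> T \<Longrightarrow> t powr (1 - \<beta>) * abel_integral \<beta> h t \<le> B"
proof (cases "T > 0")
  case True
  obtain c where c: "0 < c"
    "\<And>t. 0 < t \<Longrightarrow> t \<le> T \<Longrightarrow> t powr (1 - \<beta>) * abel_integral \<beta> (\<lambda>s. exp (- c * (t - s)) * h s) t \<le> 1"
    using exp_weighted_abel_small[OF True zero_less_one] by metis
  have "t powr (1 - \<beta>) * abel_integral \<beta> h t \<le> exp (c * T)" if t: "0 < t" "t \<le> T" for t
  proof -
    have ei: "integrable lborel (\<lambda>s. abel_kernel \<beta> 0 t s * (exp (- c * (t - s)) * h s))"
      using c h_nonneg by (intro abel_integrable[where C = 1]) (auto simp: abs_mult mult_left_le_one_le)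
    have "abel_integral \<beta> h t \<le> (LINT s|lborel. exp (c * T) * (abel_kernel \<beta> 0 t s * (exp (- c * (t - s)) * h s)))"
      unfolding abel_integral_def
    proof (rule integral_mono[OF h_int[OF t(1)] integrable_mult_right[OF ei]])
      fix s
      show "abel_kernel \<beta> 0 t s * h s \<le> exp (c * T) * (abel_kernel \<beta> 0 t s * (exp (- c * (t - s)) * h s))"
      proof (cases "0 \<le> s \<and> s < t")
        case True
        have "1 \<le> exp (c * T) * exp (- c * (t - s))"
        proof -
          have "c * (t - s) \<le> c * T" using c t True by (intro mult_left_mono) auto
          then show ?thesis by (simp flip: exp_add)
        qed
        then have "1 * (abel_kernel \<beta> 0 t s * h s) \<le> (exp (c * T) * exp (- c * (t - s))) * (abel_kernel \<beta> 0 t s * h s)"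
          using h_nonneg by (intro mult_right_mono) auto
        then show ?thesis by (simp add: mult_ac)
      qed (auto simp: abel_kernel_def)
    qed
    also have "\<dots> = exp (c * T) * abel_integral \<beta> (\<lambda>s. exp (- c * (t - s)) * h s) t"
      by (simp add: abel_integral_def)
    finally have "t powr (1 - \<beta>) * abel_integral \<beta> h t \<le> t powr (1 - \<beta>) * (exp (c * T) * abel_integral \<beta> (\<lambda>s. exp (- c * (t - s)) * h s) t)"
      by (intro mult_left_mono) auto
    also have "\<dots> = exp (c * T) * (t powr (1 - \<beta>) * abel_integral \<beta> (\<lambda>s. exp (- c * (t - s)) * h s) t)"
      by (simp add: mult_ac)
    also have "\<dots> \<le> exp (c * T) * 1"
      using c(2)[OF t] by (intro mult_left_mono) auto
    finally show ?thesis by simp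
  qed
  then show ?thesis using that[of "exp (c * T)"] by simp
qed (use that[of 0] in auto)

end

section \<open>Weights from local integrability\<close>

text \<open>
  Young's inequality is applied to \<open>(c * (t - s) powr (\<beta> - 1) * s powr (\<beta> - 1)) * (m s / c)\<close>
  with conjugate exponents \<open>q\<close> and \<open>p\<close>; the power \<open>q\<close> of the kernel is again a Beta integrand,
  with both parameters equal to \<open>x = q * (\<beta> - 1) + 1\<close>, which is positive exactly when \<open>p > 1 / \<beta>\<close>.
  For the limit at \<open>0\<close> the free scale is \<open>c = t powr \<kappa>\<close>.
\<close>
lemma
  fixes \<beta> p :: real and m :: "real \<Rightarrow> real"
  assumes beta: "0 < \<beta>" "\<beta> < 1" and p: "p > 1 / \<beta>"
    and [measurable]: "m \<in> borel_measurable borel" and m0: "\<And>s. 0 \<le> m s"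
    and mp: "\<And>T. T > 0 \<Longrightarrow> integrable lborel (\<lambda>s. indicator {0..T} s * m s powr p)"
  shows integrable_abel_kernel_Lp:
      "\<And>t. t > 0 \<Longrightarrow> integrable lborel (\<lambda>s. abel_kernel \<beta> 0 t s * (s powr (\<beta> - 1) * m s))"
    and abel_Lp_tendsto_0:
      "((\<lambda>t. t powr (1 - \<beta>) * abel_integral \<beta> (\<lambda>s. s powr (\<beta> - 1) * m s) t) \<longlongrightarrow> 0) (at_right 0)"
proof -
  define r where "r = 1 / p"
  define q where "q = 1 / (1 - r)"
  define x where "x = q * (\<beta> - 1) + 1"
  have p1: "p > 1" using p beta by (smt (verit) less_divide_eq_1_pos)
  have r: "0 < r" "r < \<beta>" using p p1 beta by (auto simp: r_def field_simps)
  have q1: "q > 1" using r beta by (simp add: q_def)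
  have pq: "1 / q + 1 / p = 1" by (simp add: q_def r_def)
  have x: "x > 0" using r beta by (simp add: x_def q_def field_simps)
  define h where "h = (\<lambda>s. s powr (\<beta> - 1) * m s)"
  have [measurable]: "h \<in> borel_measurable borel" unfolding h_def by measurable
  have bound: "abel_kernel \<beta> 0 t s * h s \<le>
        c powr q * (abel_kernel x 0 t s * (s - 0) powr (x - 1)) + c powr (- p) * (indicator {0..t} s * m s powr p)"
    if "c > 0" for c t s
  proof (cases "0 < s \<and> s < t")
    case False
    then have "abel_kernel \<beta> 0 t s * h s = 0" by (auto simp: abel_kernel_def h_def)
    then show ?thesis using that by (auto intro!: add_nonneg_nonneg mult_nonneg_nonneg)
  next
    case True
    define u where "u = c * ((t - s) powr (\<beta> - 1) * s powr (\<beta> - 1))"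
    define v where "v = m s / c"
    have "abel_kernel \<beta> 0 t s * h s = u * v"
      using True that by (simp add: abel_kernel_def h_def u_def v_def)
    also have "\<dots> \<le> u powr q / q + v powr p / p"
      using that m0 by (intro Youngs_inequality q1 p1 pq) (auto simp: u_def v_def)
    also have "\<dots> \<le> u powr q + v powr p"
      using q1 p1 by (intro add_mono) (simp_all add: divide_le_eq mult_le_cancel_left1)
    also have "u powr q = c powr q * (abel_kernel x 0 t s * (s - 0) powr (x - 1))"
      using True that by (simp add: u_def abel_kernel_def powr_mult powr_powr x_def mult.commute)
    also have "v powr p = c powr (- p) * (indicator {0..t} s * m s powr p)"
      using True that m0[of s] by (simp add: v_def powr_divide powr_minus_divide)
    finally show ?thesis .
  qed
  have h0: "0 \<le> abel_kernel \<beta> 0 t s * h s" for t s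
    using m0 by (simp add: h_def)
  have rhs: "has_bochner_integral lborel (\<lambda>s. c powr q * (abel_kernel x 0 t s * (s - 0) powr (x - 1)) +
         c powr (- p) * (indicator {0..t} s * m s powr p))
       (c powr q * ((t - 0) powr (x + x - 1) * Beta x x) + c powr (- p) * (LBINT s. indicator {0..t} s * m s powr p))"
    if "t > 0" for c t
    using that x mp
    by (intro has_bochner_integral_add has_bochner_integral_mult_right has_bochner_integral_Beta
         has_bochner_integral_integrable) auto
  have int: "integrable lborel (\<lambda>s. abel_kernel \<beta> 0 t s * h s)" if "t > 0" for t
  proof (rule Bochner_Integration.integrable_bound)
    show "integrable lborel (\<lambda>s. 1 powr q * (abel_kernel x 0 t s * (s - 0) powr (x - 1)) +
         1 powr (- p) * (indicator {0..t} s * m s powr p))"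
      using rhs[OF that, of 1] by (rule integrable.intros)
    show "AE s in lborel. norm (abel_kernel \<beta> 0 t s * h s) \<le> norm (1 powr q * (abel_kernel x 0 t s * (s - 0) powr (x - 1)) +
         1 powr (- p) * (indicator {0..t} s * m s powr p))"
      using bound[of 1 t] h0[of t] by (intro always_eventually allI) (smt (verit) real_norm_def)
  qed measurable
  then show "\<And>t. t > 0 \<Longrightarrow> integrable lborel (\<lambda>s. abel_kernel \<beta> 0 t s * (s powr (\<beta> - 1) * m s))"
    by (simp add: h_def)
  define N where "N = (LBINT s. indicator {0..1} s * m s powr p)"
  \<comment> \<open>After multiplication by \<open>t powr (1 - \<beta>)\<close> the two terms carry the exponents \<open>e1\<close> and \<open>e2\<close>.  Positivity
       of both confines \<open>\<kappa>\<close> to the interval from \<open>(2 - \<beta>) * r - \<beta>\<close> to \<open>(1 - \<beta>) * r\<close>, which is nonempty as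
       \<open>r < \<beta>\<close>; this is its midpoint.\<close>
  define \<kappa> where "\<kappa> = ((3 - 2 * \<beta>) * r - \<beta>) / 2"
  define e1 where "e1 = 1 - \<beta> + \<kappa> * q + (x + x - 1)"
  define e2 where "e2 = 1 - \<beta> - \<kappa> * p"
  have "e1 = ((\<beta> - r) / 2) / (1 - r)"
  proof -
    have "(1 - r) * e1 = (1 - r) * (2 - \<beta>) + \<kappa> * (q * (1 - r)) + 2 * (\<beta> - 1) * (q * (1 - r))"
      unfolding e1_def x_def by (simp add: algebra_simps)
    also have "q * (1 - r) = 1" using r beta by (simp add: q_def)
    finally have "(1 - r) * e1 = (\<beta> - r) / 2" by (simp add: \<kappa>_def field_simps)
    then show ?thesis using r beta by (simp add: field_simps)
  qed
  then have e1: "e1 > 0" using r beta by simp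
  have "e2 = (\<beta> * p - 1) / 2"
    using p1 by (simp add: e2_def \<kappa>_def r_def field_simps)
  then have e2: "e2 > 0" using p beta by (simp add: field_simps)
  show "((\<lambda>t. t powr (1 - \<beta>) * abel_integral \<beta> (\<lambda>s. s powr (\<beta> - 1) * m s) t) \<longlongrightarrow> 0) (at_right 0)"
  proof (rule tendsto_sandwich)
    show "\<forall>\<^sub>F t in at_right 0. 0 \<le> t powr (1 - \<beta>) * abel_integral \<beta> (\<lambda>s. s powr (\<beta> - 1) * m s) t"
      unfolding abel_integral_def using m0
      by (intro always_eventually allI mult_nonneg_nonneg integral_nonneg) auto
    show "\<forall>\<^sub>F t in at_right 0. t powr (1 - \<beta>) * abel_integral \<beta> (\<lambda>s. s powr (\<beta> - 1) * m s) t
            \<le> t powr e1 * Beta x x + t powr e2 * N"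
    proof -
      have "t powr (1 - \<beta>) * abel_integral \<beta> h t \<le> t powr e1 * Beta x x + t powr e2 * N" if t: "0 < t" "t < 1" for t
      proof -
        have "abel_integral \<beta> h t \<le> (t powr \<kappa>) powr q * ((t - 0) powr (x + x - 1) * Beta x x) +
            (t powr \<kappa>) powr (- p) * (LBINT s. indicator {0..t} s * m s powr p)"
          unfolding abel_integral_def has_bochner_integral_integral_eq[OF rhs[OF t(1)], symmetric]
          using t by (intro integral_mono int bound integrable.intros[OF rhs]) auto
        also have "(LBINT s. indicator {0..t} s * m s powr p) \<le> N"
          unfolding N_def using t by (intro integral_mono mp) (auto simp: indicator_def)
        finally have "abel_integral \<beta> h t \<le> t powr (\<kappa> * q) * (t powr (x + x - 1) * Beta x x) + t powr (- \<kappa> * p) * N"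
          using t by (simp add: powr_powr mult_left_mono)
        then have "t powr (1 - \<beta>) * abel_integral \<beta> h t \<le>
            t powr (1 - \<beta>) * (t powr (\<kappa> * q) * (t powr (x + x - 1) * Beta x x) + t powr (- \<kappa> * p) * N)"
          by (rule mult_left_mono) simp
        also have "\<dots> = t powr e1 * Beta x x + t powr e2 * N"
          using t by (simp add: e1_def e2_def powr_add powr_diff powr_minus field_simps)
        finally show ?thesis .
      qed
      then show ?thesis unfolding h_def eventually_at_right_field by (intro exI[of _ 1]) auto
    qed
    have "((\<lambda>t. t powr e1 * Beta x x + t powr e2 * N) \<longlongrightarrow> 0 powr e1 * Beta x x + 0 powr e2 * N) (at_right 0)"
      using e1 e2 by (intro tendsto_intros tendsto_powr') (auto intro!: eventually_at_right_less[THEN eventually_mono])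
    then show "((\<lambda>t. t powr e1 * Beta x x + t powr e2 * N) \<longlongrightarrow> 0) (at_right 0)"
      by simp
  qed simp
qed

lemma abel_weight_add:
  assumes "abel_weight \<beta> h1" "abel_weight \<beta> h2"
  shows "abel_weight \<beta> (\<lambda>s. h1 s + h2 s)"
proof -
  interpret h1: abel_weight \<beta> h1 by fact
  interpret h2: abel_weight \<beta> h2 by fact
  have int: "integrable lborel (\<lambda>s. abel_kernel \<beta> 0 t s * (h1 s + h2 s))"
    and add: "abel_integral \<beta> (\<lambda>s. h1 s + h2 s) t = abel_integral \<beta> h1 t + abel_integral \<beta> h2 t" if "0 < t" for t
    using h1.h_int[OF that] h2.h_int[OF that] by (simp_all add: distrib_left abel_integral_def)
  show ?thesis
  proof
    show "continuous_on {0<..} (\<lambda>s. h1 s + h2 s)"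
      by (intro continuous_intros h1.h_cont h2.h_cont)
    have "((\<lambda>t. t powr (1 - \<beta>) * abel_integral \<beta> h1 t + t powr (1 - \<beta>) * abel_integral \<beta> h2 t) \<longlongrightarrow> 0) (at_right 0)"
      using tendsto_add[OF h1.h_small h2.h_small] by simp
    moreover have "\<forall>\<^sub>F t in at_right 0. t powr (1 - \<beta>) * abel_integral \<beta> h1 t + t powr (1 - \<beta>) * abel_integral \<beta> h2 t
        = t powr (1 - \<beta>) * abel_integral \<beta> (\<lambda>s. h1 s + h2 s) t"
      using eventually_at_right_less[of "0::real"] by eventually_elim (simp add: add distrib_left)
    ultimately show "((\<lambda>t. t powr (1 - \<beta>) * abel_integral \<beta> (\<lambda>s. h1 s + h2 s) t) \<longlongrightarrow> 0) (at_right 0)"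
      by (rule Lim_transform_eventually)
  qed (simp_all add: h1.beta h1.h_nonneg h2.h_nonneg h1.h_zero h2.h_zero int)
qed

text \<open>
  Local \<open>L\<^sup>p\<close> functions are only Lebesgue measurable a priori and arbitrary at \<open>0\<close>; cutting off at
  \<open>s \<le> 0\<close> gives a Borel function that agrees almost everywhere on \<open>[0, T]\<close>.
\<close>
lemma abel_weight_of_Lp_loc:
  assumes beta: "0 < \<beta>" "\<beta> < 1" and p: "p > 1 / \<beta>" and cont: "continuous_on {0<..} g" and Lp: "Lp_loc p g"
  shows "abel_weight \<beta> (\<lambda>s. if 0 < s then s powr (\<beta> - 1) * \<bar>g s\<bar> else 0)"
proof -
  define m where "m s = (if 0 < s then \<bar>g s\<bar> else 0)" for s
  have m_cont: "continuous_on {0<..} m"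
    by (rule continuous_on_eq[of _ "\<lambda>s. \<bar>g s\<bar>"]) (auto intro!: continuous_intros cont simp: m_def)
  then have m_meas[measurable]: "m \<in> borel_measurable borel"
    by (rule borel_measurable_continuous_pos) (simp add: m_def)
  have m0: "0 \<le> m s" for s by (simp add: m_def)
  have mp: "integrable lborel (\<lambda>s. indicator {0..T} s * m s powr p)" if "0 < T" for T
  proof -
    have I: "integrable lebesgue (\<lambda>s. indicator {0..T} s *\<^sub>R (\<bar>g s\<bar> powr p))"
      using Lp that by (simp add: Lp_loc_def set_integrable_def)
    have AE: "AE s in lebesgue. indicator {0..T} s *\<^sub>R (\<bar>g s\<bar> powr p) = indicator {0..T} s * m s powr p"
      using AE_completion[OF AE_lborel_singleton[of "0::real"]]
      by eventually_elim (auto simp: m_def indicator_def)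
    have mm: "(\<lambda>s. indicator {0..T} s * m s powr p) \<in> borel_measurable lborel" by measurable
    have "integrable lebesgue (\<lambda>s. indicator {0..T} s * m s powr p)"
      by (rule integrable_cong_AE_imp[OF I measurable_completion[OF mm] AE])
    then show ?thesis using mm by (simp add: integrable_completion)
  qed
  have e: "(\<lambda>s. if 0 < s then s powr (\<beta> - 1) * \<bar>g s\<bar> else 0) = (\<lambda>s. s powr (\<beta> - 1) * m s)"
    by (auto simp: m_def)
  show ?thesis unfolding e
  proof
    show "continuous_on {0<..} (\<lambda>s. s powr (\<beta> - 1) * m s)"
      by (intro continuous_intros m_cont) auto
    show "integrable lborel (\<lambda>s. abel_kernel \<beta> 0 t s * (s powr (\<beta> - 1) * m s))" if "0 < t" for t
      using integrable_abel_kernel_Lp[OF beta p m_meas m0 mp that] .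
    show "((\<lambda>t. t powr (1 - \<beta>) * abel_integral \<beta> (\<lambda>s. s powr (\<beta> - 1) * m s) t) \<longlongrightarrow> 0) (at_right 0)"
      using abel_Lp_tendsto_0[OF beta p m_meas m0 mp] .
  qed (use beta m0 in \<open>auto simp: m_def\<close>)
qed

section \<open>Existence for the weighted Volterra equation\<close>

text \<open>
  The factor \<open>s powr (1 - \<beta>)\<close> in the growth condition is the weight of the unknown: for
  \<open>x = s powr (\<beta> - 1) * z\<close> it becomes linear growth in \<open>z\<close> with coefficient \<open>h\<close>.
\<close>
locale abel_equation = abel_weight +
  fixes f :: "real \<Rightarrow> real \<Rightarrow> real" and x0 :: real
  assumes f_cont: "continuous_on ({0<..} \<times> UNIV) (\<lambda>(t, x). f t x)"
    and growth: "\<And>s x. 0 < s \<Longrightarrow> \<bar>f s x\<bar> \<le> h s * (1 + s powr (1 - \<beta>) * \<bar>x\<bar>)"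
begin

definition forcing :: "(real \<Rightarrow> real) \<Rightarrow> real \<Rightarrow> real" where
  "forcing z s = (if 0 < s then f s (s powr (\<beta> - 1) * z s) else 0)"

text \<open>
  The right-hand side of the integral equation for \<open>y t = t powr (1 - \<beta>) * x t\<close>.  The constant value
  \<open>x0\<close> for \<open>t \<le> 0\<close> serves as the history of the delayed equations.
\<close>
definition volterra :: "(real \<Rightarrow> real) \<Rightarrow> real \<Rightarrow> real" where
  "volterra z t = (if 0 < t then x0 + t powr (1 - \<beta>) / Gamma \<beta> * abel_integral \<beta> (forcing z) t else x0)"

lemma Gamma_pos: "0 < Gamma \<beta>"
  using beta by (intro Gamma_real_pos)

lemma forcing_continuous:
  assumes "continuous_on {0<..} z"
  shows "continuous_on {0<..} (forcing z)"
proof -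
  have "continuous_on {0<..} (\<lambda>s. (\<lambda>(t, x). f t x) (s, s powr (\<beta> - 1) * z s))"
    by (rule continuous_on_compose2[OF f_cont]) (auto intro!: continuous_intros assms)
  then show ?thesis
    by (rule continuous_on_eq) (simp add: forcing_def)
qed

lemma forcing_measurable:
  assumes "continuous_on {0<..} z"
  shows "forcing z \<in> borel_measurable borel"
  using forcing_continuous[OF assms] by (rule borel_measurable_continuous_pos) (simp add: forcing_def)

lemma forcing_bound: "\<bar>forcing z s\<bar> \<le> (1 + \<bar>z s\<bar>) * h s"
proof (cases "0 < s")
  case True
  have "s powr (1 - \<beta>) * \<bar>s powr (\<beta> - 1) * z s\<bar> = \<bar>z s\<bar>"
    using True by (simp add: abs_mult mult.assoc[symmetric] flip: powr_add)
  then show ?thesis using growth[OF True, of "s powr (\<beta> - 1) * z s"] True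
    by (simp add: forcing_def mult.commute)
qed (simp add: forcing_def h_nonneg)

lemma forcing_bound_const:
  assumes "\<bar>z s\<bar> \<le> R"
  shows "\<bar>forcing z s\<bar> \<le> (1 + R) * h s"
  using forcing_bound[of z s] mult_right_mono[of "1 + \<bar>z s\<bar>" "1 + R" "h s"] assms h_nonneg[of s] by linarith

text \<open>Causality is what makes a stepwise construction of the delayed solutions possible.\<close>
lemma volterra_cong:
  assumes "\<And>s. s < t \<Longrightarrow> z s = z' s"
  shows "volterra z t = volterra z' t"
proof -
  have "(\<lambda>s. abel_kernel \<beta> 0 t s * forcing z s) = (\<lambda>s. abel_kernel \<beta> 0 t s * forcing z' s)"
    using assms by (auto simp: abel_kernel_def forcing_def fun_eq_iff)
  then show ?thesis by (simp only: volterra_def abel_integral_def)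
qed

text \<open>
  The modulus \<open>\<delta>\<close> depends on the bound \<open>R\<close> for \<open>z\<close> but not on \<open>z\<close>.  At \<open>t0 = 0\<close> it comes from the
  smallness of the weight, at \<open>t0 > 0\<close> from \<open>abel_increment\<close>.
\<close>
lemma volterra_equicontinuous:
  assumes "0 < e" and R: "0 \<le> R"
  obtains \<delta> where "0 < \<delta>" "\<delta> \<le> 1"
    "\<And>z t. \<lbrakk>continuous_on {0<..} z; \<And>s. s \<le> t0 + 1 \<Longrightarrow> \<bar>z s\<bar> \<le> R; \<bar>t - t0\<bar> < \<delta>\<rbrakk> \<Longrightarrow> \<bar>volterra z t - volterra z t0\<bar> < e"
proof -
  consider "t0 < 0" | "t0 = 0" | "0 < t0" by linarith
  then show ?thesis
  proof cases
    case 1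
    then show ?thesis using assms by (intro that[of "min 1 (- t0)"]) (auto simp: volterra_def)
  next
    case 2
    have "((\<lambda>t. (1 + R) / Gamma \<beta> * (t powr (1 - \<beta>) * abel_integral \<beta> h t)) \<longlongrightarrow> (1 + R) / Gamma \<beta> * 0) (at_right 0)"
      by (intro tendsto_mult tendsto_const h_small)
    then have "eventually (\<lambda>t. (1 + R) / Gamma \<beta> * (t powr (1 - \<beta>) * abel_integral \<beta> h t) < e) (at_right 0)"
      using assms by (intro order_tendstoD) auto
    then obtain \<delta> where \<delta>: "\<delta> > 0" "\<And>t. 0 < t \<Longrightarrow> t < \<delta> \<Longrightarrow> (1 + R) / Gamma \<beta> * (t powr (1 - \<beta>) * abel_integral \<beta> h t) < e"
      unfolding eventually_at_right_field by auto
    have "\<bar>volterra z t - volterra z t0\<bar> < e"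
      if z: "continuous_on {0<..} z" "\<And>s. s \<le> t0 + 1 \<Longrightarrow> \<bar>z s\<bar> \<le> R" "\<bar>t - t0\<bar> < min 1 \<delta>" for z t
    proof (cases "0 < t")
      case True
      have "\<bar>abel_integral \<beta> (forcing z) t\<bar> \<le> (1 + R) * abel_integral \<beta> h t"
        using 2 z by (intro abel_abs_le forcing_measurable forcing_bound_const) auto
      then have "t powr (1 - \<beta>) / Gamma \<beta> * \<bar>abel_integral \<beta> (forcing z) t\<bar> \<le> t powr (1 - \<beta>) / Gamma \<beta> * ((1 + R) * abel_integral \<beta> h t)"
        using Gamma_pos by (intro mult_left_mono) auto
      also have "\<dots> = (1 + R) / Gamma \<beta> * (t powr (1 - \<beta>) * abel_integral \<beta> h t)" by simp
      also have "\<dots> < e" using \<delta>(2)[OF True] z 2 by auto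
      finally show ?thesis using True 2 Gamma_pos by (simp add: volterra_def abs_mult)
    qed (use 2 assms in \<open>simp add: volterra_def\<close>)
    then show ?thesis using \<delta> by (intro that[of "min 1 \<delta>"]) auto
  next
    case 3
    define a where "a = t0 / 4"
    have a: "0 < a" using 3 by (simp add: a_def)
    obtain M where M: "0 \<le> M" "\<And>s. a \<le> s \<Longrightarrow> s \<le> t0 + 1 \<Longrightarrow> h s \<le> M"
      using h_bounded_away_from_0[OF a] by metis
    define A where "A = (LINT s|lborel. indicator {0..a} s * h s)"
    define \<omega> where "\<omega> r = (1 + R) * ((1 - \<beta>) * a powr (\<beta> - 2) * A * r + 2 * M / \<beta> * r powr \<beta>)" for r
    define W where "W t = (t0 + 1) powr (1 - \<beta>) * \<omega> \<bar>t - t0\<bar>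
       + \<bar>t powr (1 - \<beta>) - t0 powr (1 - \<beta>)\<bar> * ((1 + R) * abel_integral \<beta> h t0)" for t
    have "(W \<longlongrightarrow> (t0 + 1) powr (1 - \<beta>) * ((1 + R) * ((1 - \<beta>) * a powr (\<beta> - 2) * A * \<bar>t0 - t0\<bar> + 2 * M / \<beta> * \<bar>t0 - t0\<bar> powr \<beta>))
       + \<bar>t0 powr (1 - \<beta>) - t0 powr (1 - \<beta>)\<bar> * ((1 + R) * abel_integral \<beta> h t0)) (at t0)"
      unfolding W_def \<omega>_def using beta 3
      by (intro tendsto_intros tendsto_powr') (auto intro!: always_eventually)
    then have "(W \<longlongrightarrow> 0) (at t0)" using beta by simp
    then have "eventually (\<lambda>t. W t < Gamma \<beta> * e) (at t0)"
      using assms Gamma_pos by (intro order_tendstoD) auto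
    then obtain d where d: "d > 0" "\<And>t. t \<noteq> t0 \<Longrightarrow> \<bar>t - t0\<bar> < d \<Longrightarrow> W t < Gamma \<beta> * e"
      unfolding eventually_at by (auto simp: dist_real_def)
    \<comment> \<open>Since \<open>a = t0 / 4\<close>, all \<open>t\<close> with \<open>\<bar>t - t0\<bar> < t0 / 2\<close> satisfy \<open>2 * a \<le> t\<close>.\<close>
    define \<delta> where "\<delta> = min (min 1 d) (t0 / 2)"
    have "\<bar>volterra z t - volterra z t0\<bar> < e"
      if z: "continuous_on {0<..} z" "\<And>s. s \<le> t0 + 1 \<Longrightarrow> \<bar>z s\<bar> \<le> R" "\<bar>t - t0\<bar> < \<delta>" for z t
    proof (cases "t = t0")
      case False
      have t: "t0 / 2 \<le> t" "t \<le> t0 + 1" "\<bar>t - t0\<bar> < d"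
        using z(3) unfolding \<delta>_def by linarith+
      have inc: "\<bar>abel_integral \<beta> (forcing z) v - abel_integral \<beta> (forcing z) u\<bar> \<le> \<omega> (v - u)"
        if "t0 / 2 \<le> u" "u \<le> v" "v \<le> t0 + 1" for u v
        unfolding \<omega>_def A_def using that a R z M
        by (intro abel_increment[where C = "1 + R" and M = M] forcing_measurable forcing_bound_const) (auto simp: a_def)
      have "\<bar>abel_integral \<beta> (forcing z) t - abel_integral \<beta> (forcing z) t0\<bar> \<le> \<omega> \<bar>t - t0\<bar>"
        using inc[of t t0] inc[of t0 t] t 3 by (cases "t \<le> t0") (auto simp: abs_minus_commute)
      moreover have "t powr (1 - \<beta>) \<le> (t0 + 1) powr (1 - \<beta>)" using t 3 beta by (intro powr_mono2) auto
      ultimately have "t powr (1 - \<beta>) * \<bar>abel_integral \<beta> (forcing z) t - abel_integral \<beta> (forcing z) t0\<bar> \<le> (t0 + 1) powr (1 - \<beta>) * \<omega> \<bar>t - t0\<bar>"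
        by (intro mult_mono) auto
      moreover have "\<bar>abel_integral \<beta> (forcing z) t0\<bar> \<le> (1 + R) * abel_integral \<beta> h t0"
        using z by (intro abel_abs_le forcing_measurable forcing_bound_const) auto
      then have "\<bar>t powr (1 - \<beta>) - t0 powr (1 - \<beta>)\<bar> * \<bar>abel_integral \<beta> (forcing z) t0\<bar> \<le> \<bar>t powr (1 - \<beta>) - t0 powr (1 - \<beta>)\<bar> * ((1 + R) * abel_integral \<beta> h t0)"
        by (intro mult_left_mono) auto
      moreover have "t powr (1 - \<beta>) * abel_integral \<beta> (forcing z) t - t0 powr (1 - \<beta>) * abel_integral \<beta> (forcing z) t0
          = t powr (1 - \<beta>) * (abel_integral \<beta> (forcing z) t - abel_integral \<beta> (forcing z) t0)
            + (t powr (1 - \<beta>) - t0 powr (1 - \<beta>)) * abel_integral \<beta> (forcing z) t0"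
        by (simp add: algebra_simps)
      then have "\<bar>t powr (1 - \<beta>) * abel_integral \<beta> (forcing z) t - t0 powr (1 - \<beta>) * abel_integral \<beta> (forcing z) t0\<bar>
          \<le> t powr (1 - \<beta>) * \<bar>abel_integral \<beta> (forcing z) t - abel_integral \<beta> (forcing z) t0\<bar>
            + \<bar>t powr (1 - \<beta>) - t0 powr (1 - \<beta>)\<bar> * \<bar>abel_integral \<beta> (forcing z) t0\<bar>"
        by (metis abs_mult abs_of_nonneg abs_triangle_ineq powr_ge_zero)
      ultimately have "\<bar>t powr (1 - \<beta>) * abel_integral \<beta> (forcing z) t - t0 powr (1 - \<beta>) * abel_integral \<beta> (forcing z) t0\<bar> \<le> W t"
        unfolding W_def by linarith
      also have "W t < Gamma \<beta> * e" using d False t by auto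
      finally have "\<bar>t powr (1 - \<beta>) * abel_integral \<beta> (forcing z) t - t0 powr (1 - \<beta>) * abel_integral \<beta> (forcing z) t0\<bar> / Gamma \<beta> < e"
        using Gamma_pos by (simp add: divide_less_eq mult.commute)
      moreover have "volterra z t - volterra z t0 = (t powr (1 - \<beta>) * abel_integral \<beta> (forcing z) t - t0 powr (1 - \<beta>) * abel_integral \<beta> (forcing z) t0) / Gamma \<beta>"
        using t 3 by (simp add: volterra_def diff_divide_distrib)
      ultimately show ?thesis using Gamma_pos by simp
    qed (use assms in simp)
    then show ?thesis using d 3 by (intro that[of \<delta>]) (auto simp: \<delta>_def)
  qed
qed

lemma volterra_continuous:
  assumes "continuous_on UNIV z" "\<And>s. s \<le> 0 \<Longrightarrow> z s = z 0"
  shows "continuous_on UNIV (volterra z)"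
proof -
  have "isCont (volterra z) t0" for t0
  proof -
    have "compact (z ` {0..max 0 (t0 + 1)})"
      using assms by (intro compact_continuous_image continuous_on_subset[OF assms(1)]) auto
    then obtain R where R: "\<And>s. s \<in> {0..max 0 (t0 + 1)} \<Longrightarrow> norm (z s) \<le> R"
      using bounded_iff compact_imp_bounded by (metis image_eqI)
    have zR: "\<bar>z s\<bar> \<le> R" if "s \<le> t0 + 1" for s
      using R[of s] R[of 0] assms(2)[of s] that by (cases "s \<le> 0") auto
    have R0: "0 \<le> R" using R[of 0] by auto
    show ?thesis unfolding continuous_at_eps_delta
    proof (intro allI impI)
      fix e :: real assume "0 < e"
      from volterra_equicontinuous[OF this R0, of t0] zR continuous_on_subset[OF assms(1), of "{0<..}"]
      show "\<exists>d>0. \<forall>x'. dist x' t0 < d \<longrightarrow> dist (volterra z x') (volterra z t0) < e"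
        by (metis dist_real_def subset_UNIV)
    qed
  qed
  then show ?thesis by (simp add: continuous_on_eq_continuous_at)
qed

text \<open>
  The iterates \<open>Y j\<close> of the delayed operator agree with the solution up to time \<open>j * d\<close>, because
  values up to time \<open>t\<close> depend only on values up to time \<open>t - d\<close>.
\<close>
lemma delayed_solution_exists:
  assumes d: "0 < d"
  obtains y where "continuous_on UNIV y" "\<And>t. y t = volterra (\<lambda>s. y (s - d)) t"
proof -
  define Y where "Y = rec_nat (\<lambda>_::real. x0) (\<lambda>_ z. volterra (\<lambda>s. z (s - d)))"
  have Y_0: "Y 0 = (\<lambda>_. x0)" and Y_Suc: "Y (Suc j) = volterra (\<lambda>s. Y j (s - d))" for j
    by (simp_all add: Y_def)
  have Y_nonpos: "Y j t = x0" if "t \<le> 0" for j t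
    using that by (cases j) (auto simp: Y_0 Y_Suc volterra_def)
  have Y_cont: "continuous_on UNIV (Y j)" for j
  proof (induction j)
    case (Suc j)
    have "continuous_on UNIV (\<lambda>s. Y j (s - d))"
      by (rule continuous_on_compose2[OF Suc]) (auto intro!: continuous_intros)
    moreover have "Y j (s - d) = Y j (0 - d)" if "s \<le> 0" for s
      using that d by (simp add: Y_nonpos)
    ultimately show ?case unfolding Y_Suc by (rule volterra_continuous)
  qed (simp add: Y_0)
  have step: "Y (Suc j) t = Y j t" if "t \<le> real j * d" for j t
    using that
  proof (induction j arbitrary: t)
    case 0
    then show ?case by (simp add: Y_nonpos)
  next
    case (Suc j)
    have "Y (Suc j) (s - d) = Y j (s - d)" if "s < t" for s
      using that Suc.prems by (intro Suc.IH) (simp add: algebra_simps)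
    then show ?case
      unfolding Y_Suc[of "Suc j"] by (subst (2) Y_Suc) (rule volterra_cong)
  qed
  have stable: "Y (j + i) t = Y j t" if "t \<le> real j * d" for i j t
  proof (induction i)
    case (Suc i)
    have "real j * d \<le> real (j + i) * d" using d by (intro mult_right_mono) auto
    then show ?case using step[of t "j + i"] that Suc by simp
  qed simp
  define y where "y t = Y (nat \<lceil>t / d\<rceil>) t" for t
  have y: "y t = Y j t" if "t \<le> real j * d" for j t
  proof -
    have "t / d \<le> real j" using that d by (simp add: field_simps)
    then have "nat \<lceil>t / d\<rceil> \<le> j" by linarith
    then obtain i where i: "j = nat \<lceil>t / d\<rceil> + i" using le_Suc_ex by blast
    have "t / d \<le> real (nat \<lceil>t / d\<rceil>)" by linarith
    then have "t \<le> real (nat \<lceil>t / d\<rceil>) * d" using d by (simp add: field_simps)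
    from stable[OF this, of i] show ?thesis by (simp add: y_def i)
  qed
  have ex: "\<exists>j. T \<le> real j * d" for T
    using real_arch_simple[of "T / d"] d by (simp add: field_simps)
  show ?thesis
  proof (rule that)
    have "isCont y t" for t
    proof -
      obtain j where j: "t + 1 \<le> real j * d" using ex by blast
      have "isCont (Y j) t" using Y_cont[of j] by (simp add: continuous_on_eq_continuous_at)
      moreover have "eventually (\<lambda>s. y s = Y j s) (nhds t)"
        using j by (intro eventually_nhds_in_open[of "{..<t + 1}", THEN eventually_mono]) (auto intro!: y)
      ultimately show ?thesis using isCont_cong by blast
    qed
    then show "continuous_on UNIV y" by (simp add: continuous_on_eq_continuous_at)
    show "y t = volterra (\<lambda>s. y (s - d)) t" for t
    proof -
      obtain j where j: "t \<le> real j * d" using ex by blast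
      have "y t = Y (Suc j) t" using j d by (intro y) (simp add: algebra_simps)
      also have "\<dots> = volterra (\<lambda>s. Y j (s - d)) t" by (simp add: Y_Suc)
      also have "\<dots> = volterra (\<lambda>s. y (s - d)) t"
        using j d by (intro volterra_cong y[symmetric]) auto
      finally show ?thesis .
    qed
  qed
qed

text \<open>
  Evaluate the equation at a point \<open>u\<close> where \<open>exp (- c * t) * \<bar>y t\<bar>\<close> is maximal on \<open>[0, T']\<close>.  By the
  choice of \<open>c\<close>, the maximum \<open>Z\<close> satisfies \<open>Z \<le> A + Z / 2\<close>, where neither \<open>A\<close> nor \<open>c\<close> depends on the
  delay.
\<close>
lemma delayed_solutions_bounded:
  obtains R where "0 \<le> R"
    "\<And>d y t. \<lbrakk>0 < d; continuous_on UNIV y; \<And>t. y t = volterra (\<lambda>s. y (s - d)) t; t \<le> T\<rbrakk> \<Longrightarrow> \<bar>y t\<bar> \<le> R"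
proof -
  define T' where "T' = max 1 T"
  have T': "0 < T'" "T \<le> T'" by (auto simp: T'_def)
  obtain c where c: "0 < c"
    "\<And>t. 0 < t \<Longrightarrow> t \<le> T' \<Longrightarrow> t powr (1 - \<beta>) * abel_integral \<beta> (\<lambda>s. exp (- c * (t - s)) * h s) t \<le> Gamma \<beta> / 2"
    using exp_weighted_abel_small[OF T'(1), of "Gamma \<beta> / 2"] Gamma_pos by auto
  obtain B where B: "0 \<le> B" "\<And>t. 0 < t \<Longrightarrow> t \<le> T' \<Longrightarrow> t powr (1 - \<beta>) * abel_integral \<beta> h t \<le> B"
    using abel_h_bounded[of T'] by blast
  define A where "A = \<bar>x0\<bar> + (1 + \<bar>x0\<bar>) * B / Gamma \<beta>"
  have A: "\<bar>x0\<bar> \<le> A" using B Gamma_pos by (simp add: A_def)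
  define R where "R = 2 * A * exp (c * T')"
  have "\<bar>y t\<bar> \<le> R" if d: "0 < d" and y: "continuous_on UNIV y" and eq: "\<And>t. y t = volterra (\<lambda>s. y (s - d)) t" and t: "t \<le> T" for d y t
  proof -
    have y0: "y s = x0" if "s \<le> 0" for s using that by (subst eq) (simp add: volterra_def)
    have "continuous_on {0..T'} (\<lambda>t. exp (- c * t) * \<bar>y t\<bar>)"
      by (intro continuous_intros continuous_on_subset[OF y]) auto
    then obtain u where u: "u \<in> {0..T'}" "\<And>s. s \<in> {0..T'} \<Longrightarrow> exp (- c * s) * \<bar>y s\<bar> \<le> exp (- c * u) * \<bar>y u\<bar>"
      using continuous_attains_sup[of "{0..T'}" "\<lambda>t. exp (- c * t) * \<bar>y t\<bar>"] T' by auto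
    define Z where "Z = exp (- c * u) * \<bar>y u\<bar>"
    have Z0: "0 \<le> Z" by (simp add: Z_def)
    have yZ: "\<bar>y s\<bar> \<le> Z * exp (c * s)" if "s \<in> {0..T'}" for s
    proof -
      have "exp (c * s) * (exp (- c * s) * \<bar>y s\<bar>) \<le> exp (c * s) * Z"
        using u(2)[OF that] unfolding Z_def by (intro mult_left_mono) auto
      moreover have "exp (c * s) * (exp (- c * s) * \<bar>y s\<bar>) = \<bar>y s\<bar>" by (simp add: exp_minus)
      ultimately show ?thesis by (simp only: mult.commute)
    qed
    have "Z \<le> 2 * A"
    proof (cases "u = 0")
      case True
      then have "Z = \<bar>x0\<bar>" by (simp add: Z_def y0)
      then show ?thesis using A by linarith
    next
      case False
      then have u0: "0 < u" "u \<le> T'" using u(1) by auto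
      define z where "z s = y (s - d)" for s
      have zc: "continuous_on {0<..} z" unfolding z_def
        by (rule continuous_on_compose2[OF y]) (auto intro!: continuous_intros)
      have zb: "\<bar>z s\<bar> \<le> \<bar>x0\<bar> + Z * exp (c * s)" if "s < u" for s
      proof (cases "s \<le> d")
        case True
        then show ?thesis using Z0 by (simp add: z_def y0)
      next
        case False
        have "\<bar>z s\<bar> \<le> Z * exp (c * (s - d))" unfolding z_def using False that u0 d by (intro yZ) auto
        also have "\<dots> \<le> Z * exp (c * s)" using Z0 c d by (intro mult_left_mono) (auto simp: mult_left_mono)
        finally show ?thesis by simp
      qed
      let ?e = "\<lambda>s. exp (- c * (u - s)) * h s"
      have ei: "integrable lborel (\<lambda>s. abel_kernel \<beta> 0 u s * ?e s)"
        using c h_nonneg by (intro abel_integrable[where C = 1]) (auto simp: abs_mult mult_left_le_one_le)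
      let ?R = "\<lambda>s. (1 + \<bar>x0\<bar>) * (abel_kernel \<beta> 0 u s * h s) + Z * exp (c * u) * (abel_kernel \<beta> 0 u s * ?e s)"
      have Ri: "integrable lborel ?R"
        by (intro Bochner_Integration.integrable_add integrable_mult_right ei h_int u0)
      have fb: "\<bar>forcing z s\<bar> \<le> (1 + \<bar>x0\<bar> + Z * exp (c * u)) * h s" if "s < u" for s
      proof -
        have "Z * exp (c * s) \<le> Z * exp (c * u)" using that c Z0 by (intro mult_left_mono) auto
        then have "\<bar>z s\<bar> \<le> \<bar>x0\<bar> + Z * exp (c * u)" using zb[OF that] by linarith
        from forcing_bound_const[of z s, OF this] show ?thesis by (simp add: add.assoc)
      qed
      have "\<bar>abel_integral \<beta> (forcing z) u\<bar> \<le> (LINT s|lborel. ?R s)"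
        unfolding abel_integral_def
      proof (rule integral_abs_bound_integral[OF _ Ri])
        show "integrable lborel (\<lambda>s. abel_kernel \<beta> 0 u s * forcing z s)"
          by (intro abel_integrable[where C = "1 + \<bar>x0\<bar> + Z * exp (c * u)"] forcing_measurable zc fb)
        fix s
        show "\<bar>abel_kernel \<beta> 0 u s * forcing z s\<bar> \<le> ?R s"
        proof (cases "0 \<le> s \<and> s < u")
          case True
          have "exp (c * s) = exp (c * u) * exp (- c * (u - s))"
            by (simp add: algebra_simps flip: exp_add)
          then have "\<bar>z s\<bar> \<le> \<bar>x0\<bar> + Z * exp (c * u) * exp (- c * (u - s))" using zb[of s] True by simp
          from forcing_bound_const[of z s, OF this]
          have "abel_kernel \<beta> 0 u s * \<bar>forcing z s\<bar> \<le> abel_kernel \<beta> 0 u s * ((1 + (\<bar>x0\<bar> + Z * exp (c * u) * exp (- c * (u - s)))) * h s)"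
            by (intro mult_left_mono) auto
          also have "\<dots> = ?R s" by (simp add: algebra_simps)
          finally show ?thesis by (simp add: abs_mult)
        qed (auto simp: abel_kernel_def)
      qed
      also have "\<dots> = (1 + \<bar>x0\<bar>) * abel_integral \<beta> h u + Z * exp (c * u) * abel_integral \<beta> ?e u"
        unfolding abel_integral_def using ei h_int[OF u0(1)] by simp
      finally have "u powr (1 - \<beta>) * \<bar>abel_integral \<beta> (forcing z) u\<bar> \<le> u powr (1 - \<beta>) * ((1 + \<bar>x0\<bar>) * abel_integral \<beta> h u + Z * exp (c * u) * abel_integral \<beta> ?e u)"
        by (intro mult_left_mono) auto
      also have "\<dots> = (1 + \<bar>x0\<bar>) * (u powr (1 - \<beta>) * abel_integral \<beta> h u) + Z * exp (c * u) * (u powr (1 - \<beta>) * abel_integral \<beta> ?e u)"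
        by (simp add: algebra_simps)
      also have "\<dots> \<le> (1 + \<bar>x0\<bar>) * B + Z * exp (c * u) * (Gamma \<beta> / 2)"
        using B(2)[OF u0] c(2)[OF u0] Z0 by (intro add_mono mult_left_mono) auto
      finally have "u powr (1 - \<beta>) * \<bar>abel_integral \<beta> (forcing z) u\<bar> / Gamma \<beta> \<le> ((1 + \<bar>x0\<bar>) * B + Z * exp (c * u) * (Gamma \<beta> / 2)) / Gamma \<beta>"
        using Gamma_pos by (intro divide_right_mono) auto
      also have "\<dots> = (1 + \<bar>x0\<bar>) * B / Gamma \<beta> + Z * exp (c * u) / 2"
        using Gamma_pos by (simp add: field_simps)
      moreover have "y u = x0 + u powr (1 - \<beta>) * abel_integral \<beta> (forcing z) u / Gamma \<beta>"
        using u0 eq[of u] by (simp add: volterra_def z_def[abs_def])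
      then have "\<bar>y u\<bar> \<le> \<bar>x0\<bar> + \<bar>u powr (1 - \<beta>) * abel_integral \<beta> (forcing z) u / Gamma \<beta>\<bar>" by linarith
      moreover have "\<bar>u powr (1 - \<beta>) * abel_integral \<beta> (forcing z) u / Gamma \<beta>\<bar> = u powr (1 - \<beta>) * \<bar>abel_integral \<beta> (forcing z) u\<bar> / Gamma \<beta>"
        using Gamma_pos by (simp add: abs_mult)
      ultimately have "\<bar>y u\<bar> \<le> A + Z * exp (c * u) / 2" by (simp add: A_def)
      then have "exp (- c * u) * \<bar>y u\<bar> \<le> exp (- c * u) * (A + Z * exp (c * u) / 2)"
        by (intro mult_left_mono) auto
      also have "\<dots> = exp (- c * u) * A + Z * (exp (- c * u) * exp (c * u)) / 2" by (simp add: algebra_simps)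
      also have "exp (- c * u) * exp (c * u) = 1" by (simp flip: exp_add)
      also have "exp (- c * u) * A \<le> 1 * A" using c u0 A by (intro mult_right_mono) auto
      finally show ?thesis by (simp add: Z_def)
    qed
    moreover have "\<bar>y t\<bar> \<le> Z * exp (c * T') \<or> \<bar>y t\<bar> \<le> A"
    proof (cases "t \<le> 0")
      case False
      then have "\<bar>y t\<bar> \<le> Z * exp (c * t)" using t T' by (intro yZ) auto
      also have "\<dots> \<le> Z * exp (c * T')" using Z0 c t T' by (intro mult_left_mono) auto
      finally show ?thesis ..
    qed (use y0 A in simp)
    moreover have "Z * exp (c * T') \<le> R" if "Z \<le> 2 * A"
      using that unfolding R_def by (intro mult_right_mono) auto
    moreover have "A \<le> R"
    proof -
      have "A * 1 \<le> A * (2 * exp (c * T'))" using A c T' one_le_exp_iff[of "c * T'"]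
        by (intro mult_left_mono) (auto intro: order_trans[of _ "2 * 1"])
      then show ?thesis by (simp add: R_def mult_ac)
    qed
    ultimately show ?thesis by linarith
  qed
  moreover have "0 \<le> R" using A by (simp add: R_def)
  ultimately show ?thesis using that by blast
qed

text \<open>
  The delayed solutions for \<open>d n = 1 / (n + 1)\<close> are divided by their local bounds \<open>R q + 1\<close> to
  extract a subsequence converging at every rational \<open>q\<close>.  Equicontinuity extends the convergence to
  all points, makes the limit continuous, and also absorbs the vanishing delay.
\<close>
theorem volterra_fixed_point:
  obtains y where "continuous_on UNIV y" "\<And>t. y t = volterra y t"
proof -
  define d where "d n = inverse (real (Suc n))" for n
  have d: "0 < d n" for n by (simp add: d_def)
  have d_lim: "d \<longlonglongrightarrow> 0" unfolding d_def by (rule LIMSEQ_inverse_real_of_nat)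
  have "\<forall>n. \<exists>y. continuous_on UNIV y \<and> (\<forall>t. y t = volterra (\<lambda>s. y (s - d n)) t)"
    using delayed_solution_exists[OF d] by metis
  then obtain Y where Yc: "\<And>n. continuous_on UNIV (Y n)"
    and Yeq: "\<And>n t. Y n t = volterra (\<lambda>s. Y n (s - d n)) t" by metis
  have "\<forall>T. \<exists>R\<ge>0. \<forall>n t. t \<le> T \<longrightarrow> \<bar>Y n t\<bar> \<le> R"
  proof
    fix T
    obtain R where "0 \<le> R"
      "\<And>d y t. \<lbrakk>0 < d; continuous_on UNIV y; \<And>t. y t = volterra (\<lambda>s. y (s - d)) t; t \<le> T\<rbrakk> \<Longrightarrow> \<bar>y t\<bar> \<le> R"
      using delayed_solutions_bounded[of T] by blast
    then show "\<exists>R\<ge>0. \<forall>n t. t \<le> T \<longrightarrow> \<bar>Y n t\<bar> \<le> R" using d Yc Yeq by blast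
  qed
  then obtain R where R0: "\<And>T. 0 \<le> R T" and R: "\<And>T n t. t \<le> T \<Longrightarrow> \<bar>Y n t\<bar> \<le> R T" by metis
  define z where "z n s = Y n (s - d n)" for n s
  have zc: "continuous_on {0<..} (z n)" for n unfolding z_def
    by (rule continuous_on_compose2[OF Yc]) (auto intro!: continuous_intros)
  have zR: "\<bar>z n s\<bar> \<le> R T" if "s \<le> T" for n s T
    unfolding z_def using d[of n] that by (intro R) auto
  have Yz: "Y n t = volterra (z n) t" for n t unfolding z_def by (rule Yeq)
  have equi: "\<exists>\<delta>>0. \<forall>n t. \<bar>t - t0\<bar> < \<delta> \<longrightarrow> \<bar>Y n t - Y n t0\<bar> < e" if "0 < e" for e t0
    using volterra_equicontinuous[OF that R0[of "t0 + 1"], of t0] zc zR Yz by metis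
  have "norm (Y n q / (R q + 1)) \<le> 1" for n q
    using R[of q q n] R0[of q] by simp
  then obtain k where k: "strict_mono k" "\<And>q. q \<in> \<rat> \<Longrightarrow> \<exists>l. (\<lambda>n. Y (k n) q / (R q + 1)) \<longlonglongrightarrow> l"
    using function_convergent_subsequence[OF countable_rat, of "\<lambda>n q. Y n q / (R q + 1)" 1] by blast
  have conv_rat: "Cauchy (\<lambda>n. Y (k n) q)" if q: "q \<in> \<rat>" for q
  proof -
    obtain l where "(\<lambda>n. Y (k n) q / (R q + 1)) \<longlonglongrightarrow> l" using k(2)[OF q] by blast
    then have "(\<lambda>n. Y (k n) q / (R q + 1) * (R q + 1)) \<longlonglongrightarrow> l * (R q + 1)"
      by (intro tendsto_mult tendsto_const)
    moreover have "R q + 1 \<noteq> 0" using R0[of q] by linarith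
    ultimately show ?thesis using LIMSEQ_imp_Cauchy by simp
  qed
  have "convergent (\<lambda>n. Y (k n) t)" for t
    unfolding Cauchy_convergent_iff[symmetric]
  proof (rule metric_CauchyI)
    fix e :: real assume "0 < e"
    then obtain \<delta> where \<delta>: "\<delta> > 0" "\<And>n s. \<bar>s - t\<bar> < \<delta> \<Longrightarrow> \<bar>Y n s - Y n t\<bar> < e / 3"
      using equi[of "e / 3" t] by auto
    obtain q where q: "q \<in> \<rat>" "t < q" "q < t + \<delta>" using Rats_dense_in_real[of t "t + \<delta>"] \<delta> by auto
    obtain N where N: "\<And>m n. m \<ge> N \<Longrightarrow> n \<ge> N \<Longrightarrow> dist (Y (k m) q) (Y (k n) q) < e / 3"
      using metric_CauchyD[OF conv_rat[OF q(1)], of "e / 3"] \<open>0 < e\<close> by auto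
    have "dist (Y (k m) t) (Y (k n) t) < e" if "m \<ge> N" "n \<ge> N" for m n
      using N[OF that] \<delta>(2)[of q "k m"] \<delta>(2)[of q "k n"] q unfolding dist_real_def by linarith
    then show "\<exists>M. \<forall>m\<ge>M. \<forall>n\<ge>M. dist (Y (k m) t) (Y (k n) t) < e" by blast
  qed
  moreover define y where "y t = lim (\<lambda>n. Y (k n) t)" for t
  ultimately have y: "(\<lambda>n. Y (k n) t) \<longlonglongrightarrow> y t" for t
    by (simp add: convergent_LIMSEQ_iff)
  have equi_y: "\<exists>\<delta>>0. \<forall>t. \<bar>t - t0\<bar> < \<delta> \<longrightarrow> \<bar>y t - y t0\<bar> < e" if e: "0 < e" for e t0
  proof -
    obtain \<delta> where \<delta>: "\<delta> > 0" "\<And>n t. \<bar>t - t0\<bar> < \<delta> \<Longrightarrow> \<bar>Y n t - Y n t0\<bar> < e / 2"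
      using equi[OF half_gt_zero[OF e], of t0] by blast
    have "\<bar>y t - y t0\<bar> \<le> e / 2" if "\<bar>t - t0\<bar> < \<delta>" for t
      by (rule LIMSEQ_le_const2[OF tendsto_rabs[OF tendsto_diff[OF y y]]])
        (use \<delta>(2)[OF that] in \<open>auto intro!: exI[of _ 0] less_imp_le\<close>)
    then show ?thesis using \<delta>(1) e by (intro exI[of _ \<delta>]) force
  qed
  then have yc: "continuous_on UNIV y"
    by (auto simp: continuous_on_iff dist_real_def)
  have z_lim: "(\<lambda>n. z (k n) s) \<longlonglongrightarrow> y s" for s
  proof -
    have "(\<lambda>n. z (k n) s - Y (k n) s) \<longlonglongrightarrow> 0"
    proof (rule LIMSEQ_I)
      fix e :: real assume "0 < e"
      then obtain \<delta> where \<delta>: "\<delta> > 0" "\<And>n t. \<bar>t - s\<bar> < \<delta> \<Longrightarrow> \<bar>Y n t - Y n s\<bar> < e"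
        using equi[of e s] by blast
      have "(\<lambda>n. d (k n)) \<longlonglongrightarrow> 0" using LIMSEQ_subseq_LIMSEQ[OF d_lim k(1)] by (simp add: comp_def)
      then have "\<forall>\<^sub>F n in sequentially. d (k n) < \<delta>" using \<delta>(1) by (rule order_tendstoD)
      then obtain N where "\<And>n. n \<ge> N \<Longrightarrow> d (k n) < \<delta>" by (auto simp: eventually_sequentially)
      then show "\<exists>N. \<forall>n\<ge>N. norm (z (k n) s - Y (k n) s - 0) < e"
        by (intro exI[of _ N]) (auto simp: z_def abs_of_pos[OF d] intro!: \<delta>(2))
    qed
    from tendsto_add[OF this y[of s]] show ?thesis by simp
  qed
  have forcing_lim: "(\<lambda>n. forcing (z (k n)) s) \<longlonglongrightarrow> forcing y s" for s
  proof (cases "0 < s")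
    case True
    have "isCont (\<lambda>(t, x). f t x) (s, s powr (\<beta> - 1) * y s)"
      using f_cont True by (auto simp: continuous_on_eq_continuous_at open_Times)
    moreover have "(\<lambda>n. (s, s powr (\<beta> - 1) * z (k n) s)) \<longlonglongrightarrow> (s, s powr (\<beta> - 1) * y s)"
      by (intro tendsto_intros z_lim)
    ultimately have "(\<lambda>n. (\<lambda>(t, x). f t x) (s, s powr (\<beta> - 1) * z (k n) s))
        \<longlonglongrightarrow> (\<lambda>(t, x). f t x) (s, s powr (\<beta> - 1) * y s)"
      by (rule isCont_tendsto_compose)
    then show ?thesis using True by (simp add: forcing_def)
  qed (simp add: forcing_def)
  have "(\<lambda>n. volterra (z (k n)) t) \<longlonglongrightarrow> volterra y t" for t
  proof (cases "0 < t")
    case True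
    have "(\<lambda>n. abel_integral \<beta> (forcing (z (k n))) t) \<longlonglongrightarrow> abel_integral \<beta> (forcing y) t"
      unfolding abel_integral_def
    proof (rule integral_dominated_convergence)
      show "integrable lborel (\<lambda>s. (1 + R t) * (abel_kernel \<beta> 0 t s * h s))"
        by (intro integrable_mult_right h_int True)
      show "(\<lambda>s. abel_kernel \<beta> 0 t s * forcing y s) \<in> borel_measurable lborel"
        using forcing_measurable[OF continuous_on_subset[OF yc]] by measurable
      show "(\<lambda>s. abel_kernel \<beta> 0 t s * forcing (z (k n)) s) \<in> borel_measurable lborel" for n
        using forcing_measurable[OF zc, of "k n"] by measurable
      show "AE s in lborel. (\<lambda>n. abel_kernel \<beta> 0 t s * forcing (z (k n)) s) \<longlonglongrightarrow> abel_kernel \<beta> 0 t s * forcing y s"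
        by (intro always_eventually allI tendsto_mult tendsto_const forcing_lim)
      show "AE s in lborel. norm (abel_kernel \<beta> 0 t s * forcing (z (k n)) s) \<le> (1 + R t) * (abel_kernel \<beta> 0 t s * h s)" for n
      proof (intro always_eventually allI)
        fix s
        show "norm (abel_kernel \<beta> 0 t s * forcing (z (k n)) s) \<le> (1 + R t) * (abel_kernel \<beta> 0 t s * h s)"
        proof (cases "s < t")
          case True
          have "abel_kernel \<beta> 0 t s * \<bar>forcing (z (k n)) s\<bar> \<le> abel_kernel \<beta> 0 t s * ((1 + R t) * h s)"
            using True by (intro mult_left_mono forcing_bound_const zR) auto
          then show ?thesis by (simp add: abs_mult mult_ac)
        qed (simp add: abel_kernel_def)
      qed
    qed
    then show ?thesis using True Gamma_pos by (auto simp: volterra_def intro!: tendsto_intros)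
  qed (simp add: volterra_def)
  then have "y t = volterra y t" for t
    using y[of t] unfolding Yz by (metis LIMSEQ_unique)
  with yc that show ?thesis by blast
qed

end

section \<open>Asymptotics of Abel integrals\<close>

text \<open>
  The mass of \<open>g\<close> on \<open>[0, T]\<close> is forgotten at rate \<open>(t - T) powr (\<beta> - 1)\<close>, and the tail is compared
  with \<open>s powr (- \<beta>)\<close>, whose Abel integral over \<open>[0, t]\<close> is the Beta integral with parameters
  \<open>1 - \<beta>\<close> and \<open>\<beta>\<close>, hence independent of \<open>t\<close>.
\<close>
lemma abel_tail_estimate:
  assumes beta: "0 < \<beta>" "\<beta> < 1" and [measurable]: "g \<in> borel_measurable borel"
    and int: "\<And>t. 0 < t \<Longrightarrow> integrable lborel (\<lambda>s. abel_kernel \<beta> 0 t s * g s)"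
    and T: "0 < T" "T < t" and g: "\<And>s. T \<le> s \<Longrightarrow> s < t \<Longrightarrow> \<bar>g s\<bar> \<le> C * s powr (- \<beta>)" and C: "0 \<le> C"
  shows "\<bar>abel_integral \<beta> g t\<bar> \<le> (t - T) powr (\<beta> - 1) * (LINT s|lborel. \<bar>indicator {0..T} s * g s\<bar>)
           + C * (Gamma \<beta> * Gamma (1 - \<beta>))"
proof -
  define R where "R s = (t - T) powr (\<beta> - 1) * \<bar>indicator {0..T} s * g s\<bar>
      + C * (abel_kernel \<beta> 0 t s * (s - 0) powr ((1 - \<beta>) - 1))" for s
  have i: "integrable lborel (\<lambda>s. indicator {0..T} s * g s)"
    using T by (intro integrable_of_abel_kernel[OF beta] int) auto
  have "has_bochner_integral lborel R ((t - T) powr (\<beta> - 1) * (LINT s|lborel. \<bar>indicator {0..T} s * g s\<bar>)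
      + C * ((t - 0) powr (1 - \<beta> + \<beta> - 1) * Beta (1 - \<beta>) \<beta>))"
    unfolding R_def using beta T i
    by (intro has_bochner_integral_add has_bochner_integral_mult_right has_bochner_integral_Beta
        has_bochner_integral_integrable integrable_abs) auto
  then have R: "has_bochner_integral lborel R ((t - T) powr (\<beta> - 1) * (LINT s|lborel. \<bar>indicator {0..T} s * g s\<bar>)
      + C * (Gamma \<beta> * Gamma (1 - \<beta>)))"
    using T by (simp add: Beta_reflection[OF beta])
  have "\<bar>abel_kernel \<beta> 0 t s * g s\<bar> \<le> R s" for s
  proof -
    have nn: "0 \<le> (t - T) powr (\<beta> - 1) * \<bar>indicator {0..T} s * g s\<bar>"
      "0 \<le> C * (abel_kernel \<beta> 0 t s * (s - 0) powr ((1 - \<beta>) - 1))"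
      using C by auto
    consider "s < 0 \<or> s \<ge> t" | "0 \<le> s" "s < T" | "T \<le> s" "s < t" by linarith
    then show ?thesis
    proof cases
      case 1
      then have "abel_kernel \<beta> 0 t s = 0" by (auto simp: abel_kernel_def)
      then show ?thesis using nn by (simp add: R_def)
    next
      case 2
      then have "(t - s) powr (\<beta> - 1) * \<bar>g s\<bar> \<le> (t - T) powr (\<beta> - 1) * \<bar>g s\<bar>"
        using beta T by (intro mult_right_mono powr_mono2') auto
      then show ?thesis using 2 T nn(2) by (simp add: R_def abel_kernel_def abs_mult)
    next
      case 3
      have "abel_kernel \<beta> 0 t s * \<bar>g s\<bar> \<le> C * (abel_kernel \<beta> 0 t s * s powr (- \<beta>))"
        using 3 mult_left_mono[OF g, of s "abel_kernel \<beta> 0 t s"] by (simp add: mult_ac)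
      also have "\<dots> \<le> R s" using nn(1) by (simp add: R_def)
      finally show ?thesis by (simp add: abs_mult)
    qed
  qed
  then have "\<bar>abel_integral \<beta> g t\<bar> \<le> (LINT s|lborel. R s)"
    unfolding abel_integral_def using T by (intro integral_abs_bound_integral int integrable.intros[OF R]) auto
  then show ?thesis using has_bochner_integral_integral_eq[OF R] by simp
qed

lemma abel_tendsto_0:
  assumes beta: "0 < \<beta>" "\<beta> < 1" and g[measurable]: "g \<in> borel_measurable borel"
    and int: "\<And>t. 0 < t \<Longrightarrow> integrable lborel (\<lambda>s. abel_kernel \<beta> 0 t s * g s)"
    and lim: "((\<lambda>t. t powr \<beta> * g t) \<longlongrightarrow> 0) at_top"
  shows "(abel_integral \<beta> g \<longlongrightarrow> 0) at_top"
proof (rule tendstoI)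
  fix e :: real assume e: "0 < e"
  define B where "B = Gamma \<beta> * Gamma (1 - \<beta>)"
  have B: "0 < B" using beta by (simp add: B_def Gamma_real_pos)
  define C where "C = e / (2 * B)"
  have C: "0 < C" using e B by (simp add: C_def)
  have "\<forall>\<^sub>F s in at_top. dist (s powr \<beta> * g s) 0 < C" using lim C by (rule tendstoD)
  then have "\<forall>\<^sub>F s in at_top. \<bar>s powr \<beta> * g s\<bar> < C" by simp
  then obtain T' where T': "\<And>s. s \<ge> T' \<Longrightarrow> \<bar>s powr \<beta> * g s\<bar> < C"
    unfolding eventually_at_top_linorder by blast
  define T where "T = max 1 T'"
  have T: "0 < T" by (simp add: T_def)
  have gC: "\<bar>g s\<bar> \<le> C * s powr (- \<beta>)" if "T \<le> s" for s
  proof -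
    have "s > 0" "s \<ge> T'" using that by (auto simp: T_def)
    then show ?thesis using T'[of s] by (simp add: abs_mult powr_minus field_simps)
  qed
  define N where "N = (LINT s|lborel. \<bar>indicator {0..T} s * g s\<bar>)"
  have "((\<lambda>t. (t - T) powr (\<beta> - 1) * N) \<longlongrightarrow> 0 * N) at_top"
  proof (intro tendsto_mult tendsto_const tendsto_neg_powr)
    show "filterlim (\<lambda>t. t - T) at_top at_top"
      using filterlim_tendsto_add_at_top[OF tendsto_const[of "- T"] filterlim_ident] by simp
  qed (use beta in simp)
  then have "\<forall>\<^sub>F t in at_top. (t - T) powr (\<beta> - 1) * N < e / 2"
    using e by (intro order_tendstoD) auto
  then show "\<forall>\<^sub>F t in at_top. dist (abel_integral \<beta> g t) 0 < e"
    using eventually_gt_at_top[of T]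
  proof eventually_elim
    case (elim t)
    have "\<bar>abel_integral \<beta> g t\<bar> \<le> (t - T) powr (\<beta> - 1) * N + C * B"
      unfolding N_def B_def using elim C by (intro abel_tail_estimate[OF beta g int T] gC) auto
    moreover have "C * B = e / 2" using B by (simp add: C_def)
    ultimately show ?case using elim by simp
  qed
qed

text \<open>
  Subtracting \<open>b * s powr (- \<beta>)\<close>, whose Abel integral is exactly the claimed limit, reduces this to
  the case \<open>b = 0\<close>.
\<close>
lemma abel_tendsto_at_top:
  assumes beta: "0 < \<beta>" "\<beta> < 1" and g[measurable]: "g \<in> borel_measurable borel"
    and int: "\<And>t. 0 < t \<Longrightarrow> integrable lborel (\<lambda>s. abel_kernel \<beta> 0 t s * g s)"
    and lim: "((\<lambda>t. t powr \<beta> * g t) \<longlongrightarrow> b) at_top"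
  shows "(abel_integral \<beta> g \<longlongrightarrow> b * (Gamma \<beta> * Gamma (1 - \<beta>))) at_top"
proof -
  define \<psi> where "\<psi> s = g s - b * (s - 0) powr ((1 - \<beta>) - 1)" for s
  have [measurable]: "\<psi> \<in> borel_measurable borel" unfolding \<psi>_def by measurable
  have pw: "has_bochner_integral lborel (\<lambda>s. b * (abel_kernel \<beta> 0 t s * (s - 0) powr ((1 - \<beta>) - 1)))
      (b * ((t - 0) powr (1 - \<beta> + \<beta> - 1) * Beta (1 - \<beta>) \<beta>))" if "0 < t" for t
    using beta that by (intro has_bochner_integral_mult_right has_bochner_integral_Beta) auto
  have split: "abel_kernel \<beta> 0 t s * \<psi> s
     = abel_kernel \<beta> 0 t s * g s - b * (abel_kernel \<beta> 0 t s * (s - 0) powr ((1 - \<beta>) - 1))" for t s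
    by (simp add: \<psi>_def algebra_simps)
  have "(abel_integral \<beta> \<psi> \<longlongrightarrow> 0) at_top"
  proof (rule abel_tendsto_0[OF beta])
    show "integrable lborel (\<lambda>s. abel_kernel \<beta> 0 t s * \<psi> s)" if "0 < t" for t
      unfolding split using int[OF that] integrable.intros[OF pw[OF that]] by (rule Bochner_Integration.integrable_diff)
    have "((\<lambda>t. t powr \<beta> * g t - b) \<longlongrightarrow> b - b) at_top"
      by (intro tendsto_diff lim tendsto_const)
    then have "((\<lambda>t. t powr \<beta> * g t - b) \<longlongrightarrow> 0) at_top" by simp
    moreover have "\<forall>\<^sub>F t in at_top. t powr \<beta> * g t - b = t powr \<beta> * \<psi> t"
      using eventually_gt_at_top[of 0]
      by eventually_elim (simp add: \<psi>_def algebra_simps flip: powr_add)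
    ultimately show "((\<lambda>t. t powr \<beta> * \<psi> t) \<longlongrightarrow> 0) at_top"
      by (rule Lim_transform_eventually)
  qed measurable
  then have "((\<lambda>t. abel_integral \<beta> \<psi> t + b * (Gamma \<beta> * Gamma (1 - \<beta>))) \<longlongrightarrow> 0 + b * (Gamma \<beta> * Gamma (1 - \<beta>))) at_top"
    by (intro tendsto_add tendsto_const)
  then have "((\<lambda>t. abel_integral \<beta> \<psi> t + b * (Gamma \<beta> * Gamma (1 - \<beta>))) \<longlongrightarrow> b * (Gamma \<beta> * Gamma (1 - \<beta>))) at_top"
    by simp
  then show ?thesis
  proof (rule Lim_transform_eventually)
    show "\<forall>\<^sub>F t in at_top. abel_integral \<beta> \<psi> t + b * (Gamma \<beta> * Gamma (1 - \<beta>)) = abel_integral \<beta> g t"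
      using eventually_gt_at_top[of 0]
    proof eventually_elim
      case (elim t)
      have "abel_integral \<beta> \<psi> t = abel_integral \<beta> g t - b * ((t - 0) powr (1 - \<beta> + \<beta> - 1) * Beta (1 - \<beta>) \<beta>)"
        unfolding abel_integral_def split Bochner_Integration.integral_diff[OF int[OF elim] integrable.intros[OF pw[OF elim]]]
        by (subst has_bochner_integral_integral_eq[OF pw[OF elim]]) (rule refl)
      then show ?case using elim by (simp add: Beta_reflection[OF beta])
    qed
  qed
qed

text \<open>
  The solution is evaluated where \<open>\<bar>x\<bar>\<close> is maximal on \<open>[T + 1, v]\<close>.  With
  \<open>e = 1 / (2 * Gamma (1 - \<beta>))\<close> the linear term contributes at most half of that maximum, so the
  maximum is bounded independently of \<open>v\<close>.  Starting at \<open>T + 1\<close> rather than \<open>T\<close> keeps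
  \<open>(t - T) powr (\<beta> - 1)\<close> below \<open>1\<close>.
\<close>
lemma abel_solution_bounded:
  fixes x F :: "real \<Rightarrow> real"
  assumes beta: "0 < \<beta>" "\<beta> < 1" and F[measurable]: "F \<in> borel_measurable borel"
    and int: "\<And>t. 0 < t \<Longrightarrow> integrable lborel (\<lambda>s. abel_kernel \<beta> 0 t s * F s)"
    and x: "continuous_on {0<..} x" and eq: "\<And>t. 0 < t \<Longrightarrow> x t = x0 * t powr (\<beta> - 1) + abel_integral \<beta> F t / Gamma \<beta>"
    and small: "\<And>e. 0 < e \<Longrightarrow> \<exists>T. \<forall>s\<ge>T. \<bar>F s\<bar> \<le> (A + e * \<bar>x s\<bar>) * s powr (- \<beta>)"
  obtains X where "\<And>t. 1 \<le> t \<Longrightarrow> \<bar>x t\<bar> \<le> X"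
proof -
  define B where "B = Gamma \<beta> * Gamma (1 - \<beta>)"
  have G: "0 < Gamma \<beta>" "0 < B" using beta by (simp_all add: B_def Gamma_real_pos)
  define e where "e = Gamma \<beta> / (2 * B)"
  have e: "0 < e" using G by (simp add: e_def)
  obtain T' where T': "\<And>s. s \<ge> T' \<Longrightarrow> \<bar>F s\<bar> \<le> (A + e * \<bar>x s\<bar>) * s powr (- \<beta>)"
    using small[OF e] by blast
  define T where "T = max 1 T'"
  have T: "1 \<le> T" by (simp add: T_def)
  have FT: "\<bar>F s\<bar> \<le> (A + e * \<bar>x s\<bar>) * s powr (- \<beta>)" if "s \<ge> T" for s
    using T' that by (simp add: T_def)
  have bdd: "\<exists>M\<ge>0. \<forall>s\<in>{1..v}. \<bar>x s\<bar> \<le> M" for v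
  proof -
    have "compact (x ` {1..v})"
      by (intro compact_continuous_image continuous_on_subset[OF x]) auto
    then obtain M where "\<forall>s\<in>{1..v}. norm (x s) \<le> M"
      using bounded_iff compact_imp_bounded by (metis image_eqI)
    then show ?thesis by (intro exI[of _ "max 0 M"]) force
  qed
  obtain M where M: "0 \<le> M" "\<And>s. s \<in> {1..T + 1} \<Longrightarrow> \<bar>x s\<bar> \<le> M" using bdd by metis
  define N where "N = (LINT s|lborel. \<bar>indicator {0..T} s * F s\<bar>)"
  have N: "0 \<le> N" unfolding N_def by (intro Bochner_Integration.integral_nonneg) auto
  define D where "D = 2 * (\<bar>x0\<bar> + (N + (\<bar>A\<bar> + e * M) * B) / Gamma \<beta>)"
  have "\<bar>x v\<bar> \<le> D" if v: "T + 1 \<le> v" for v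
  proof -
    have "continuous_on {T + 1..v} (\<lambda>s. \<bar>x s\<bar>)"
      using T by (intro continuous_intros continuous_on_subset[OF x]) auto
    then obtain t where t: "t \<in> {T + 1..v}" "\<And>s. s \<in> {T + 1..v} \<Longrightarrow> \<bar>x s\<bar> \<le> \<bar>x t\<bar>"
      using continuous_attains_sup[of "{T + 1..v}" "\<lambda>s. \<bar>x s\<bar>"] v by auto
    define C where "C = \<bar>A\<bar> + e * (M + \<bar>x t\<bar>)"
    have "\<bar>abel_integral \<beta> F t\<bar> \<le> (t - T) powr (\<beta> - 1) * N + C * B"
      unfolding N_def B_def
    proof (rule abel_tail_estimate[OF beta F int])
      show "0 \<le> C" using e M by (simp add: C_def)
      show "\<bar>F s\<bar> \<le> C * s powr (- \<beta>)" if s: "T \<le> s" "s < t" for s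
      proof -
        have "\<bar>x s\<bar> \<le> M + \<bar>x t\<bar>"
          using M(2)[of s] t(2)[of s] t(1) s T M(1) by (cases "s \<le> T + 1") auto
        then have "A + e * \<bar>x s\<bar> \<le> C"
          unfolding C_def using e by (intro add_mono mult_left_mono) auto
        then show ?thesis using FT[OF s(1)] mult_right_mono[of "A + e * \<bar>x s\<bar>" C "s powr (- \<beta>)"] by simp
      qed
    qed (use T t in auto)
    also have "(t - T) powr (\<beta> - 1) * N \<le> 1 * N"
      using t beta N powr_mono[of "\<beta> - 1" 0 "t - T"] by (intro mult_right_mono) auto
    finally have "\<bar>abel_integral \<beta> F t\<bar> / Gamma \<beta> \<le> (N + C * B) / Gamma \<beta>"
      using G by (intro divide_right_mono) auto
    also have "\<dots> = (N + (\<bar>A\<bar> + e * M) * B) / Gamma \<beta> + \<bar>x t\<bar> / 2"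
      using G by (simp add: C_def e_def field_simps)
    finally have a: "\<bar>abel_integral \<beta> F t / Gamma \<beta>\<bar> \<le> (N + (\<bar>A\<bar> + e * M) * B) / Gamma \<beta> + \<bar>x t\<bar> / 2"
      using G by simp
    have "\<bar>x0 * t powr (\<beta> - 1)\<bar> \<le> \<bar>x0\<bar> * 1"
      using t T beta powr_mono[of "\<beta> - 1" 0 t] unfolding abs_mult by (intro mult_left_mono) auto
    moreover have "x t = x0 * t powr (\<beta> - 1) + abel_integral \<beta> F t / Gamma \<beta>" using eq[of t] t T by simp
    ultimately have "\<bar>x t\<bar> \<le> \<bar>x0\<bar> + \<bar>abel_integral \<beta> F t / Gamma \<beta>\<bar>" by linarith
    moreover have "p \<le> 2 * (q + r)" if "p \<le> q + w" "w \<le> r + p / 2" for p q r w :: real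
      using that by (simp add: field_simps)
    ultimately have "\<bar>x t\<bar> \<le> D" using a unfolding D_def by blast
    then show ?thesis using t(2)[of v] v by auto
  qed
  then have "\<bar>x t\<bar> \<le> max M D" if "1 \<le> t" for t
    using M(2)[of t] that by (cases "t \<le> T + 1") (auto simp: le_max_iff_disj)
  with that show ?thesis by blast
qed

section \<open>From the Volterra equation to the fractional derivative\<close>

text \<open>
  Exchange the order of integration over \<open>0 \<le> r < s < t\<close>.  The inner integral in \<open>s\<close> is the Beta
  integral of \<open>(t - s) powr (- \<beta>) * (s - r) powr (\<beta> - 1)\<close>, which does not depend on \<open>r\<close> or \<open>t\<close>.
\<close>
lemma abel_semigroup:
  fixes \<beta> t :: real
  assumes beta: "0 < \<beta>" "\<beta> < 1" and [measurable]: "F \<in> borel_measurable borel" and t: "0 < t"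
    and F: "integrable lborel (\<lambda>s. indicator {0..t} s * F s)"
  shows "has_bochner_integral lborel (\<lambda>s. abel_kernel (1 - \<beta>) 0 t s * abel_integral \<beta> F s)
    (Gamma \<beta> * Gamma (1 - \<beta>) * (LINT s|lborel. indicator {0..t} s * F s))"
proof -
  define B where "B = Gamma \<beta> * Gamma (1 - \<beta>)"
  have B: "0 < B" using beta by (simp add: B_def Gamma_real_pos)
  define \<Phi> :: "real \<Rightarrow> real \<Rightarrow> real" where
    "\<Phi> r s = (if 0 \<le> r \<and> r < s \<and> s < t then F r * ((t - s) powr (1 - \<beta> - 1) * (s - r) powr (\<beta> - 1)) else 0)" for r s
  have \<Phi>1: "\<Phi> r s = (indicator {0..} r * F r) * (abel_kernel (1 - \<beta>) r t s * (s - r) powr (\<beta> - 1))" for r s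
    by (auto simp: \<Phi>_def abel_kernel_def)
  have \<Phi>2: "\<Phi> r s = abel_kernel (1 - \<beta>) 0 t s * (abel_kernel \<beta> 0 s r * F r)" for r s
    by (auto simp: \<Phi>_def abel_kernel_def)
  have meas: "(\<lambda>(r, s). \<Phi> r s) \<in> borel_measurable (lborel \<Otimes>\<^sub>M lborel)"
    unfolding \<Phi>_def by measurable
  have inner: "has_bochner_integral lborel (\<lambda>s. abel_kernel (1 - \<beta>) r t s * (s - r) powr (\<beta> - 1)) B" if "r < t" for r
    using has_bochner_integral_Beta[of \<beta> "1 - \<beta>" r t] beta that by (simp add: Beta_reflection B_def)
  have trivial: "(\<lambda>s. abel_kernel (1 - \<beta>) r t s * (s - r) powr (\<beta> - 1)) = (\<lambda>_. 0)" if "t \<le> r" for r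
    using that by (auto simp: abel_kernel_def fun_eq_iff)
  have int1: "has_bochner_integral lborel (\<Phi> r) (indicator {0..<t} r * F r * B)" for r
  proof (cases "r < t")
    case True
    have "has_bochner_integral lborel (\<Phi> r) ((indicator {0..} r * F r) * B)"
      unfolding \<Phi>1 by (rule has_bochner_integral_mult_right) (rule inner[OF True])
    moreover have "indicator {0..} r * F r * B = indicator {0..<t} r * F r * B" using True by (simp add: indicator_def)
    ultimately show ?thesis by simp
  next
    case False
    then have "\<Phi> r = (\<lambda>_. 0)" by (auto simp: \<Phi>_def fun_eq_iff)
    then show ?thesis using False by (simp add: has_bochner_integral_zero)
  qed
  have int1n: "(LINT s|lborel. norm (\<Phi> r s)) = B * \<bar>indicator {0..<t} r * F r\<bar>" for r
  proof -
    have "(LINT s|lborel. norm (\<Phi> r s))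
        = (LINT s|lborel. \<bar>indicator {0..} r * F r\<bar> * (abel_kernel (1 - \<beta>) r t s * (s - r) powr (\<beta> - 1)))"
      by (simp add: \<Phi>1 abs_mult)
    also have "\<dots> = \<bar>indicator {0..} r * F r\<bar> * (LINT s|lborel. abel_kernel (1 - \<beta>) r t s * (s - r) powr (\<beta> - 1))"
      by (rule integral_mult_right_zero)
    also have "\<dots> = B * \<bar>indicator {0..<t} r * F r\<bar>"
    proof (cases "r < t")
      case True
      then show ?thesis using has_bochner_integral_integral_eq[OF inner[OF True]] by (simp add: indicator_def)
    next
      case False
      then show ?thesis using trivial[of r] by simp
    qed
    finally show ?thesis .
  qed
  have F': "integrable lborel (\<lambda>s. indicator {0..<t} s * F s)"
  proof (rule Bochner_Integration.integrable_bound[OF F])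
    show "AE s in lborel. norm (indicator {0..<t} s * F s) \<le> norm (indicator {0..t} s * F s)"
      by (auto simp: indicator_def)
  qed measurable
  have pair: "integrable (lborel \<Otimes>\<^sub>M lborel) (\<lambda>(r, s). \<Phi> r s)"
  proof (rule lborel_pair.Fubini_integrable[OF meas])
    show "integrable lborel (\<lambda>r. LINT s|lborel. norm (case (r, s) of (r, s) \<Rightarrow> \<Phi> r s))"
      unfolding prod.case int1n using F' by (intro integrable_mult_right integrable_abs)
    show "AE r in lborel. integrable lborel (\<lambda>s. case (r, s) of (r, s) \<Rightarrow> \<Phi> r s)"
      unfolding prod.case using integrable.intros[OF int1] by simp
  qed
  have int2: "(LINT r|lborel. \<Phi> r s) = abel_kernel (1 - \<beta>) 0 t s * abel_integral \<beta> F s" for s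
    by (simp add: \<Phi>2 abel_integral_def)
  have i2: "integrable lborel (\<lambda>s. LINT r|lborel. \<Phi> r s)"
    using lborel_pair.integrable_snd[OF pair] .
  have "(LINT s|lborel. (LINT r|lborel. \<Phi> r s)) = (LINT r|lborel. (LINT s|lborel. \<Phi> r s))"
    by (rule lborel_pair.Fubini_integral[OF pair])
  then have "(LINT s|lborel. (LINT r|lborel. \<Phi> r s)) = (LINT r|lborel. indicator {0..<t} r * F r * B)"
    by (simp add: has_bochner_integral_integral_eq[OF int1])
  also have "\<dots> = B * (LINT r|lborel. indicator {0..<t} r * F r)" by simp
  also have "(LINT r|lborel. indicator {0..<t} r * F r) = (LINT r|lborel. indicator {0..t} r * F r)"
    by (intro integral_cong_AE) (use AE_lborel_singleton[of t] in \<open>auto simp: indicator_def elim!: eventually_mono\<close>)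
  finally show ?thesis using i2 unfolding int2 B_def by (simp add: has_bochner_integral_iff)
qed

text \<open>
  Absolute continuity of the integral: split \<open>\<bar>F\<bar>\<close> at a height \<open>N\<close> above which its integral is less
  than \<open>e / 2\<close>; below that height the increments over the intervals are at most \<open>N\<close> times their total
  length.  The additive constant \<open>c\<close> matters because \<open>P\<close> need not tend to \<open>0\<close> at \<open>0\<close>.
\<close>
lemma abs_continuous_on_integral:
  fixes F P :: "real \<Rightarrow> real"
  assumes F: "integrable lborel (\<lambda>s. indicator {0..T} s * F s)"
    and P: "\<And>t. 0 < t \<Longrightarrow> t \<le> T \<Longrightarrow> P t = c + (LINT s|lborel. indicator {0..t} s * F s)"
  shows "abs_continuous_on {0<..T} P"
  unfolding abs_continuous_on_def
proof (intro allI impI)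
  fix e :: real assume e: "0 < e"
  define G where "G s = \<bar>indicator {0..T} s * F s\<bar>" for s
  have G: "integrable lborel G" unfolding G_def using F by (rule integrable_abs)
  have G0: "0 \<le> G s" for s by (simp add: G_def)
  have [measurable]: "G \<in> borel_measurable borel" using G by auto
  define Q where "Q N s = (if G s > real N then G s else 0)" for N :: nat and s
  have [measurable]: "Q N \<in> borel_measurable borel" for N unfolding Q_def by measurable
  have Qi: "integrable lborel (Q N)" for N
    by (rule Bochner_Integration.integrable_bound[OF G]) (auto simp: Q_def G0)
  have "(\<lambda>N. LINT s|lborel. Q N s) \<longlonglongrightarrow> integral\<^sup>L lborel (\<lambda>_::real. 0::real)"
  proof (rule integral_dominated_convergence[where w = G])
    show "integrable lborel G" by (rule G)
    show "AE s in lborel. (\<lambda>N. Q N s) \<longlonglongrightarrow> 0"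
    proof (intro always_eventually allI)
      fix s
      have "\<forall>\<^sub>F N in sequentially. Q N s = 0"
      proof -
        obtain M where "G s \<le> real M" using real_arch_simple by blast
        then show ?thesis by (intro eventually_sequentiallyI[of M]) (auto simp: Q_def)
      qed
      then show "(\<lambda>N. Q N s) \<longlonglongrightarrow> 0" by (rule tendsto_eventually)
    qed
  qed (auto simp: Q_def G0)
  then have "\<forall>\<^sub>F N in sequentially. (LINT s|lborel. Q N s) < e / 2"
    using e by (intro order_tendstoD) auto
  then obtain N where N: "(LINT s|lborel. Q N s) < e / 2" by (auto simp: eventually_sequentially)
  define \<delta> where "\<delta> = e / (2 * (real N + 1))"
  have \<delta>: "0 < \<delta>" using e by (simp add: \<delta>_def)
  have "(\<Sum>i<n. \<bar>P (b i) - P (a i)\<bar>) < e"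
    if sub: "\<forall>i<n. a i \<le> b i \<and> {a i..b i} \<subseteq> {0<..T}"
      and disj: "\<forall>i<n. \<forall>j<n. i \<noteq> j \<longrightarrow> {a i<..<b i} \<inter> {a j<..<b j} = {}"
      and len: "(\<Sum>i<n. b i - a i) < \<delta>" for n :: nat and a b :: "nat \<Rightarrow> real"
  proof -
    have Qii: "integrable lborel (\<lambda>s. indicator {a i<..<b i} s * Q N s)" for i
      by (rule Bochner_Integration.integrable_bound[OF Qi[of N]]) (auto simp: Q_def G0 indicator_def)
    have each: "\<bar>P (b i) - P (a i)\<bar> \<le> real N * (b i - a i) + (LINT s|lborel. indicator {a i<..<b i} s * Q N s)" if "i < n" for i
    proof -
      have ab: "a i \<le> b i" "0 < a i" "b i \<le> T" "0 < b i" "a i \<le> T"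
        using sub that by (auto simp: subset_iff)
      have Fi: "integrable lborel (\<lambda>s. indicator {0..u} s * F s)" if "u \<le> T" for u
      proof (rule Bochner_Integration.integrable_bound[OF F])
        have "(\<lambda>s. indicator {0..u} s * F s) = (\<lambda>s. indicator {0..u} s * (indicator {0..T} s * F s))"
          using that by (auto simp: indicator_def fun_eq_iff)
        then show "(\<lambda>s. indicator {0..u} s * F s) \<in> borel_measurable lborel"
          using borel_measurable_integrable[OF F] by simp
        show "AE s in lborel. norm (indicator {0..u} s * F s) \<le> norm (indicator {0..T} s * F s)"
          using that by (auto simp: indicator_def)
      qed
      have r: "has_bochner_integral lborel (\<lambda>s. real N * indicator {a i<..<b i} s + indicator {a i<..<b i} s * Q N s)
          (real N * (b i - a i) + (LINT s|lborel. indicator {a i<..<b i} s * Q N s))"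
        using ab has_bochner_integral_real_indicator[of "{a i<..<b i}" lborel]
        by (intro has_bochner_integral_add has_bochner_integral_mult_right has_bochner_integral_integrable Qii) auto
      have "\<bar>P (b i) - P (a i)\<bar> = \<bar>LINT s|lborel. indicator {0..b i} s * F s - indicator {0..a i} s * F s\<bar>"
        using ab Fi by (simp add: P)
      also have "\<dots> \<le> (LINT s|lborel. \<bar>indicator {0..b i} s * F s - indicator {0..a i} s * F s\<bar>)"
        by (rule integral_abs_bound)
      also have "\<dots> \<le> (LINT s|lborel. real N * indicator {a i<..<b i} s + indicator {a i<..<b i} s * Q N s)"
      proof (rule integral_mono_AE)
        show "integrable lborel (\<lambda>s. \<bar>indicator {0..b i} s * F s - indicator {0..a i} s * F s\<bar>)"
          using ab Fi by (intro integrable_abs Bochner_Integration.integrable_diff) auto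
        show "integrable lborel (\<lambda>s. real N * indicator {a i<..<b i} s + indicator {a i<..<b i} s * Q N s)"
          using r by (rule integrable.intros)
        show "AE s in lborel. \<bar>indicator {0..b i} s * F s - indicator {0..a i} s * F s\<bar> \<le> real N * indicator {a i<..<b i} s + indicator {a i<..<b i} s * Q N s"
          using AE_lborel_singleton[of "b i"]
        proof eventually_elim
          case (elim s)
          show ?case using ab elim by (auto simp: indicator_def Q_def G_def)
        qed
      qed
      finally show ?thesis using has_bochner_integral_integral_eq[OF r] by simp
    qed
    have "(\<Sum>i<n. (LINT s|lborel. indicator {a i<..<b i} s * Q N s)) = (LINT s|lborel. (\<Sum>i<n. indicator {a i<..<b i} s * Q N s))"
      by (rule Bochner_Integration.integral_sum[symmetric]) (rule Qii)
    also have "\<dots> \<le> (LINT s|lborel. Q N s)"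
    proof (rule integral_mono[OF _ Qi])
      show "integrable lborel (\<lambda>s. \<Sum>i<n. indicator {a i<..<b i} s * Q N s)"
        by (intro Bochner_Integration.integrable_sum Qii)
      fix s
      have "disjoint_family_on (\<lambda>i. {a i<..<b i}) {..<n}"
        using disj by (auto simp: disjoint_family_on_def)
      then have "(\<Sum>i<n. indicator {a i<..<b i} s) = (indicator (\<Union>i<n. {a i<..<b i}) s :: real)"
        by (simp add: indicator_UN_disjoint)
      then have "(\<Sum>i<n. indicator {a i<..<b i} s * Q N s) = indicator (\<Union>i<n. {a i<..<b i}) s * Q N s"
        by (metis sum_distrib_right)
      also have "\<dots> \<le> Q N s" by (auto simp: indicator_def Q_def G0)
      finally show "(\<Sum>i<n. indicator {a i<..<b i} s * Q N s) \<le> Q N s" .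
    qed
    finally have q: "(\<Sum>i<n. (LINT s|lborel. indicator {a i<..<b i} s * Q N s)) < e / 2" using N by simp
    have "(\<Sum>i<n. \<bar>P (b i) - P (a i)\<bar>) \<le> (\<Sum>i<n. real N * (b i - a i) + (LINT s|lborel. indicator {a i<..<b i} s * Q N s))"
      by (intro sum_mono each) auto
    also have "\<dots> = real N * (\<Sum>i<n. b i - a i) + (\<Sum>i<n. (LINT s|lborel. indicator {a i<..<b i} s * Q N s))"
      by (simp add: sum.distrib sum_distrib_left)
    also have "\<dots> < e"
    proof -
      have "real N * (\<Sum>i<n. b i - a i) \<le> real N * \<delta>" using len by (intro mult_left_mono) auto
      also have "\<dots> \<le> e / 2" using e by (simp add: \<delta>_def field_simps)
      finally show ?thesis using q by linarith
    qed
    finally show ?thesis .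
  qed
  with \<delta> show "\<exists>\<delta>>0. \<forall>(n::nat) a b. (\<forall>i<n. a i \<le> b i \<and> {a i..b i} \<subseteq> {0<..T}) \<longrightarrow>
        (\<forall>i<n. \<forall>j<n. i \<noteq> j \<longrightarrow> {a i<..<b i} \<inter> {a j<..<b j} = {}) \<longrightarrow>
        (\<Sum>i<n. b i - a i) < \<delta> \<longrightarrow> (\<Sum>i<n. \<bar>P (b i) - P (a i)\<bar>) < e"
    by blast
qed

text \<open>
  The integrand may be singular at \<open>0\<close>, so the fundamental theorem is applied to the integral from
  \<open>t / 2\<close>.
\<close>
lemma has_real_derivative_integral:
  fixes F P :: "real \<Rightarrow> real"
  assumes cont: "continuous_on {0<..} F" and t: "0 < t"
    and F: "\<And>T. 0 < T \<Longrightarrow> integrable lborel (\<lambda>s. indicator {0..T} s * F s)"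
    and P: "\<And>t. 0 < t \<Longrightarrow> P t = c + (LINT s|lborel. indicator {0..t} s * F s)"
  shows "(P has_real_derivative F t) (at t)"
proof -
  have HK: "F integrable_on {0..u}" "(LINT s|lborel. indicator {0..u} s * F s) = integral {0..u} F" if "0 < u" for u
    using set_borel_integral_eq_integral[of "{0..u}" F] F[OF that]
    by (simp_all add: set_integrable_def set_lebesgue_integral_def)
  have "((\<lambda>u. integral {t / 2..u} F) has_real_derivative F t) (at t within {t / 2..t + 1})"
    using t by (intro integral_has_real_derivative continuous_on_subset[OF cont]) auto
  then have "((\<lambda>u. integral {t / 2..u} F) has_real_derivative F t) (at t)"
    using t by (subst (asm) at_within_interior) auto
  then have "((\<lambda>u. (c + integral {0..t / 2} F) + integral {t / 2..u} F) has_real_derivative 0 + F t) (at t)"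
    by (intro DERIV_add DERIV_const)
  then have D: "((\<lambda>u. (c + integral {0..t / 2} F) + integral {t / 2..u} F) has_real_derivative F t) (at t)"
    by simp
  show ?thesis
  proof (rule has_field_derivative_transform_within_open[OF D, of "{t / 2<..}"])
    fix u assume u: "u \<in> {t / 2<..}"
    have "integral {0..t / 2} F + integral {t / 2..u} F = integral {0..u} F"
      using t u HK(1)[of u] by (intro Henstock_Kurzweil_Integration.integral_combine) auto
    then show "c + integral {0..t / 2} F + integral {t / 2..u} F = P u"
      using P[of u] HK(2)[of u] u t by simp
  qed (use t in auto)
qed

text \<open>
  The integrands of both sides coincide pointwise, since \<open>0 powr _ = 0\<close> at the end point \<open>s = t\<close>; for
  Borel functions the Lebesgue and Borel integrals agree.
\<close>
lemma RL_integral_eq_abel: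
  assumes [measurable]: "x \<in> borel_measurable borel"
  shows "RL_integral \<alpha> x t = abel_integral \<alpha> x t / Gamma \<alpha>"
    and "set_integrable lebesgue {0..t} (\<lambda>s. (t - s) powr (\<alpha> - 1) * x s) \<longleftrightarrow> integrable lborel (\<lambda>s. abel_kernel \<alpha> 0 t s * x s)"
proof -
  have e: "(\<lambda>s. indicator {0..t} s *\<^sub>R ((t - s) powr (\<alpha> - 1) * x s)) = (\<lambda>s. abel_kernel \<alpha> 0 t s * x s)"
    by (auto simp: abel_kernel_def indicator_def fun_eq_iff)
  have m: "(\<lambda>s. abel_kernel \<alpha> 0 t s * x s) \<in> borel_measurable lborel" by measurable
  show "RL_integral \<alpha> x t = abel_integral \<alpha> x t / Gamma \<alpha>"
    unfolding RL_integral_def set_lebesgue_integral_def e abel_integral_def using m by (simp add: integral_completion)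
  show "set_integrable lebesgue {0..t} (\<lambda>s. (t - s) powr (\<alpha> - 1) * x s) \<longleftrightarrow> integrable lborel (\<lambda>s. abel_kernel \<alpha> 0 t s * x s)"
    unfolding set_integrable_def e using m by (simp add: integrable_completion)
qed

text \<open>
  Applying the Abel integral of order \<open>1 - \<beta>\<close> turns \<open>s powr (\<beta> - 1)\<close> into a constant and, by the
  semigroup law, the Abel integral of \<open>F\<close> into an ordinary integral.
\<close>
lemma RL_derivative_of_abel:
  fixes x F :: "real \<Rightarrow> real"
  assumes beta: "0 < \<beta>" "\<beta> < 1" and Fm[measurable]: "F \<in> borel_measurable borel" and cont: "continuous_on {0<..} F"
    and F: "\<And>T. 0 < T \<Longrightarrow> integrable lborel (\<lambda>s. indicator {0..T} s * F s)"
    and xm[measurable]: "x \<in> borel_measurable borel"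
    and x: "\<And>t. 0 \<le> t \<Longrightarrow> x t = x0 * t powr (\<beta> - 1) + abel_integral \<beta> F t / Gamma \<beta>"
    and t: "0 < t"
  shows "has_RL_derivative \<beta> x (F t) t"
proof -
  have G: "0 < Gamma \<beta>" "0 < Gamma (1 - \<beta>)" using beta by (simp_all add: Gamma_real_pos)
  have I: "has_bochner_integral lborel (\<lambda>s. abel_kernel (1 - \<beta>) 0 t s * x s)
      (x0 * (Gamma \<beta> * Gamma (1 - \<beta>)) + Gamma \<beta> * Gamma (1 - \<beta>) * (LINT s|lborel. indicator {0..t} s * F s) / Gamma \<beta>)"
    if t: "0 < t" for t
  proof -
    have "has_bochner_integral lborel (\<lambda>s. abel_kernel (1 - \<beta>) 0 t s * (s - 0) powr (\<beta> - 1)) (Gamma \<beta> * Gamma (1 - \<beta>))"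
      using has_bochner_integral_Beta[of \<beta> "1 - \<beta>" 0 t] beta t by (simp add: Beta_reflection)
    then have "has_bochner_integral lborel
      (\<lambda>s. x0 * (abel_kernel (1 - \<beta>) 0 t s * (s - 0) powr (\<beta> - 1)) + abel_kernel (1 - \<beta>) 0 t s * abel_integral \<beta> F s / Gamma \<beta>)
      (x0 * (Gamma \<beta> * Gamma (1 - \<beta>)) + Gamma \<beta> * Gamma (1 - \<beta>) * (LINT s|lborel. indicator {0..t} s * F s) / Gamma \<beta>)"
      using G by (intro has_bochner_integral_add has_bochner_integral_mult_right has_bochner_integral_divide
          abel_semigroup beta Fm t F) auto
    moreover have "x0 * (abel_kernel (1 - \<beta>) 0 t s * (s - 0) powr (\<beta> - 1)) + abel_kernel (1 - \<beta>) 0 t s * abel_integral \<beta> F s / Gamma \<beta>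
        = abel_kernel (1 - \<beta>) 0 t s * x s" for s
      using x[of s] by (cases "0 \<le> s") (auto simp: abel_kernel_def algebra_simps)
    ultimately show ?thesis by simp
  qed
  have RL: "RL_integral (1 - \<beta>) x t = x0 * Gamma \<beta> + (LINT s|lborel. indicator {0..t} s * F s)" if "0 < t" for t
    unfolding RL_integral_eq_abel[OF xm] abel_integral_def has_bochner_integral_integral_eq[OF I[OF that]]
    using G by (simp add: field_simps)
  have "set_integrable lebesgue {0..t} (\<lambda>s. (t - s) powr (- \<beta>) * x s)" if "0 < t" for t
    using RL_integral_eq_abel(2)[OF xm, of t "1 - \<beta>"] integrable.intros[OF I[OF that]] by simp
  moreover have "abs_continuous_on {0<..T} (RL_integral (1 - \<beta>) x)" if "0 < T" for T
    using F[OF that] RL by (rule abs_continuous_on_integral)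
  moreover have "(RL_integral (1 - \<beta>) x has_real_derivative F t) (at t)"
    using cont t F RL by (rule has_real_derivative_integral)
  ultimately show ?thesis by (simp add: has_RL_derivative_def RL_admissible_def)
qed

section \<open>Solutions under the sandwich condition\<close>

text \<open>
  Since \<open>0 \<le> \<mu> \<le> 1\<close>, \<open>u powr \<mu> \<le> 1 + u\<close> for \<open>u = c * \<bar>x\<bar>\<close>.  The scale \<open>c = s powr (1 - \<beta>)\<close> gives the
  growth condition near \<open>0\<close>, and \<open>c = 1\<close> the estimates at infinity.
\<close>
lemma real_power_fun_abs_le:
  assumes P: "real_power_fun \<mu> P" and mu: "0 \<le> \<mu>" "\<mu> \<le> 1" and c: "0 < c"
  shows "\<bar>P x\<bar> \<le> c powr (- \<mu>) * (1 + c * \<bar>x\<bar>)"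
proof (cases "x = 0")
  case True
  then show ?thesis using real_power_fun_0[OF P] c by simp
next
  case False
  have "(c * \<bar>x\<bar>) powr \<mu> \<le> 1 + c * \<bar>x\<bar>"
  proof (cases "c * \<bar>x\<bar> \<le> 1")
    case True
    then have "(c * \<bar>x\<bar>) powr \<mu> \<le> 1" using c mu by (intro powr_le1) auto
    then show ?thesis using c by (simp add: add_increasing2)
  next
    case False
    then have "(c * \<bar>x\<bar>) powr \<mu> \<le> (c * \<bar>x\<bar>) powr 1" using mu by (intro powr_mono) auto
    then show ?thesis using False by simp
  qed
  then have "c powr (- \<mu>) * (c powr \<mu> * \<bar>x\<bar> powr \<mu>) \<le> c powr (- \<mu>) * (1 + c * \<bar>x\<bar>)"
    using c by (intro mult_left_mono) (auto simp: powr_mult)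
  moreover have "c powr (- \<mu>) * (c powr \<mu> * \<bar>x\<bar> powr \<mu>) = \<bar>P x\<bar>"
    using real_power_fun_abs[OF P False] c by (simp add: mult.assoc[symmetric] flip: powr_add)
  ultimately show ?thesis by simp
qed

lemma abs_le_of_affine_bounds:
  fixes c c1 d d1 p q :: real
  assumes "c1 * q + d1 \<le> p" "p \<le> c * q + d"
  shows "\<bar>p\<bar> \<le> (\<bar>c\<bar> + \<bar>c1\<bar>) * \<bar>q\<bar> + (\<bar>d\<bar> + \<bar>d1\<bar>)"
proof -
  have "\<bar>p\<bar> \<le> \<bar>c * q + d\<bar> + \<bar>c1 * q + d1\<bar>" using assms by linarith
  also have "\<dots> \<le> (\<bar>c * q\<bar> + \<bar>d\<bar>) + (\<bar>c1 * q\<bar> + \<bar>d1\<bar>)"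
    by (intro add_mono abs_triangle_ineq)
  also have "\<dots> = (\<bar>c\<bar> + \<bar>c1\<bar>) * \<bar>q\<bar> + (\<bar>d\<bar> + \<bar>d1\<bar>)"
    by (simp add: abs_mult distrib_right)
  finally show ?thesis .
qed

theorem theorem3p7:
  fixes \<beta> \<gamma> \<mu> p b x0 :: real
    and l l1 k k1 :: "real \<Rightarrow> real"
    and f :: "real \<Rightarrow> real \<Rightarrow> real"
    and pow\<mu> :: "real \<Rightarrow> real"
  assumes "0 < \<beta>" and "\<beta> < \<gamma>" and "\<gamma> < 1"
    and "0 \<le> \<mu>" and "\<mu> \<le> 1"
    and "real_power_fun \<mu> pow\<mu>"
    and "p > 1 / \<beta>"
    and "continuous_on {0<..} (\<lambda>t. t powr ((1 - \<mu>) * (1 - \<beta>)) * l t)"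
    and "Lp_loc p (\<lambda>t. t powr ((1 - \<mu>) * (1 - \<beta>)) * l t)"
    and "continuous_on {0<..} (\<lambda>t. t powr ((1 - \<mu>) * (1 - \<beta>)) * l1 t)"
    and "Lp_loc p (\<lambda>t. t powr ((1 - \<mu>) * (1 - \<beta>)) * l1 t)"
    and "\<exists>K\<ge>0. \<forall>t\<ge>1. t powr \<gamma> * \<bar>l t\<bar> \<le> K \<and> t powr \<gamma> * \<bar>l1 t\<bar> \<le> K"
    and "continuous_on {0<..} (\<lambda>t. t powr (1 - \<beta>) * k t)"
    and "Lp_loc p (\<lambda>t. t powr (1 - \<beta>) * k t)"
    and "continuous_on {0<..} (\<lambda>t. t powr (1 - \<beta>) * k1 t)"
    and "Lp_loc p (\<lambda>t. t powr (1 - \<beta>) * k1 t)"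
    and "((\<lambda>t. t powr \<beta> * k t) \<longlongrightarrow> b) at_top"
    and "((\<lambda>t. t powr \<beta> * k1 t) \<longlongrightarrow> b) at_top"
    and "continuous_on ({0<..} \<times> UNIV) (\<lambda>(t, x). f t x)"
    and "\<forall>t>0. \<forall>x. l1 t * pow\<mu> x + k1 t \<le> f t x \<and> f t x \<le> l t * pow\<mu> x + k t"
  shows "\<exists>x. RL_solution \<beta> f x0 x \<and> C_weighted (1 - \<beta>) x \<and>
             (x \<longlongrightarrow> b * pi / (Gamma \<beta> * sin (\<beta> * pi))) at_top"
proof -
  note bg = \<open>\<beta> < \<gamma>\<close> and mu = \<open>0 \<le> \<mu>\<close> \<open>\<mu> \<le> 1\<close> and P = \<open>real_power_fun \<mu> pow\<mu>\<close>
  have beta: "0 < \<beta>" "\<beta> < 1" using assms(1-3) by auto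
  have G: "0 < Gamma \<beta>" using beta by (simp add: Gamma_real_pos)
  have sandwich: "l1 t * pow\<mu> x + k1 t \<le> f t x" "f t x \<le> l t * pow\<mu> x + k t" if "0 < t" for t x
    using assms(20) that by auto
  have f_abs: "\<bar>f t x\<bar> \<le> (\<bar>l t\<bar> + \<bar>l1 t\<bar>) * \<bar>pow\<mu> x\<bar> + (\<bar>k t\<bar> + \<bar>k1 t\<bar>)" if "0 < t" for t x
    using sandwich[OF that] by (rule abs_le_of_affine_bounds)
  \<comment> \<open>The weight is written as a sum of four terms so that each matches one integrability hypothesis.\<close>
  define w where "w = (\<lambda>g s. if 0 < s then s powr (\<beta> - 1) * \<bar>g s\<bar> else (0::real))"
  define a where "a = (1 - \<mu>) * (1 - \<beta>)"
  define h where "h s = (w (\<lambda>t. t powr a * l t) s + w (\<lambda>t. t powr a * l1 t) s)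
      + (w (\<lambda>t. t powr (1 - \<beta>) * k t) s + w (\<lambda>t. t powr (1 - \<beta>) * k1 t) s)" for s
  have weight: "abel_weight \<beta> h"
    unfolding h_def w_def a_def by (intro abel_weight_add abel_weight_of_Lp_loc[where p = p] beta assms)
  have h_pos: "h s = s powr (- \<mu> * (1 - \<beta>)) * (\<bar>l s\<bar> + \<bar>l1 s\<bar>) + (\<bar>k s\<bar> + \<bar>k1 s\<bar>)" if s: "0 < s" for s
  proof -
    have "\<beta> - 1 + a = - \<mu> * (1 - \<beta>)" by (simp add: a_def algebra_simps)
    then have "s powr (\<beta> - 1) * \<bar>s powr a * g\<bar> = s powr (- \<mu> * (1 - \<beta>)) * \<bar>g\<bar>"
      "s powr (\<beta> - 1) * \<bar>s powr (1 - \<beta>) * g\<bar> = \<bar>g\<bar>" for g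
      using s by (simp_all add: abs_mult mult.assoc[symmetric] flip: powr_add)
    then show ?thesis using s by (simp add: h_def w_def distrib_left)
  qed
  interpret abel_weight \<beta> h by (rule weight)
  interpret abel_equation \<beta> h f x0
  proof
    show "continuous_on ({0<..} \<times> UNIV) (\<lambda>(t, x). f t x)" by fact
    show "\<bar>f s x\<bar> \<le> h s * (1 + s powr (1 - \<beta>) * \<bar>x\<bar>)" if s: "0 < s" for s x
    proof -
      have "\<bar>pow\<mu> x\<bar> \<le> s powr (- \<mu> * (1 - \<beta>)) * (1 + s powr (1 - \<beta>) * \<bar>x\<bar>)"
        using real_power_fun_abs_le[OF P mu, of "s powr (1 - \<beta>)" x] s by (simp add: powr_powr mult.commute)
      then have "(\<bar>l s\<bar> + \<bar>l1 s\<bar>) * \<bar>pow\<mu> x\<bar>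
          \<le> (\<bar>l s\<bar> + \<bar>l1 s\<bar>) * (s powr (- \<mu> * (1 - \<beta>)) * (1 + s powr (1 - \<beta>) * \<bar>x\<bar>))"
        by (intro mult_left_mono) auto
      moreover have "(\<bar>k s\<bar> + \<bar>k1 s\<bar>) * 1 \<le> (\<bar>k s\<bar> + \<bar>k1 s\<bar>) * (1 + s powr (1 - \<beta>) * \<bar>x\<bar>)"
        by (intro mult_left_mono) auto
      moreover have "h s * (1 + s powr (1 - \<beta>) * \<bar>x\<bar>) =
          (\<bar>l s\<bar> + \<bar>l1 s\<bar>) * (s powr (- \<mu> * (1 - \<beta>)) * (1 + s powr (1 - \<beta>) * \<bar>x\<bar>))
          + (\<bar>k s\<bar> + \<bar>k1 s\<bar>) * (1 + s powr (1 - \<beta>) * \<bar>x\<bar>)"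
        unfolding h_pos[OF s] by (simp only: distrib_right mult.assoc mult.left_commute distrib_left)
      ultimately have "(\<bar>l s\<bar> + \<bar>l1 s\<bar>) * \<bar>pow\<mu> x\<bar> + (\<bar>k s\<bar> + \<bar>k1 s\<bar>) \<le> h s * (1 + s powr (1 - \<beta>) * \<bar>x\<bar>)"
        by (simp only: mult_1_right add_mono)
      with f_abs[OF s, of x] show ?thesis by (rule order_trans)
    qed
  qed
  obtain y where yc: "continuous_on UNIV y" and y: "\<And>t. y t = volterra y t"
    using volterra_fixed_point by blast
  define F where "F = forcing y"
  define x where "x t = t powr (\<beta> - 1) * y t" for t
  have F_pos: "F s = f s (x s)" if "0 < s" for s
    using that by (simp add: F_def forcing_def x_def)
  have F_cont: "continuous_on {0<..} F"
    unfolding F_def by (intro forcing_continuous continuous_on_subset[OF yc]) auto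
  have F_meas: "F \<in> borel_measurable borel"
    unfolding F_def by (intro forcing_measurable continuous_on_subset[OF yc]) auto
  have F_int: "integrable lborel (\<lambda>s. abel_kernel \<beta> 0 t s * F s)" if "0 < t" for t
  proof -
    have "compact (y ` {0..t})"
      by (intro compact_continuous_image continuous_on_subset[OF yc]) auto
    then obtain R where R: "\<forall>s\<in>{0..t}. norm (y s) \<le> R"
      using bounded_iff compact_imp_bounded by (metis image_eqI)
    show ?thesis
      using R by (intro abel_integrable[where C = "1 + R"] F_meas) (auto simp: F_def intro!: forcing_bound_const)
  qed
  have F_loc: "integrable lborel (\<lambda>s. indicator {0..T} s * F s)" if "0 < T" for T
    using that by (intro integrable_of_abel_kernel[OF beta F_meas] F_int) auto
  have x_cont: "continuous_on {0<..} x"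
    unfolding x_def by (intro continuous_intros continuous_on_subset[OF yc]) auto
  have x_eq: "x t = x0 * t powr (\<beta> - 1) + abel_integral \<beta> F t / Gamma \<beta>" if t: "0 < t" for t
  proof -
    have "y t = x0 + t powr (1 - \<beta>) / Gamma \<beta> * abel_integral \<beta> F t"
      using t y[of t] by (simp add: volterra_def F_def)
    then have "x t = x0 * t powr (\<beta> - 1) + (t powr (\<beta> - 1) * t powr (1 - \<beta>)) * abel_integral \<beta> F t / Gamma \<beta>"
      by (simp add: x_def algebra_simps)
    also have "t powr (\<beta> - 1) * t powr (1 - \<beta>) = 1"
      using t by (simp flip: powr_add)
    finally show ?thesis by simp
  qed
  have solution: "RL_solution \<beta> f x0 x"
    unfolding RL_solution_def
  proof (intro conjI allI impI)
    fix t :: real assume t: "0 < t"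
    have "y \<in> borel_measurable borel" using yc by (rule borel_measurable_continuous_onI)
    then have xm: "x \<in> borel_measurable borel" unfolding x_def by measurable
    have "abel_integral \<beta> F 0 = 0"
    proof -
      have "(\<lambda>s. abel_kernel \<beta> 0 0 s * F s) = (\<lambda>_. 0)" by (auto simp: abel_kernel_def)
      then show ?thesis by (simp add: abel_integral_def)
    qed
    \<comment> \<open>At \<open>t = 0\<close> both sides vanish, because \<open>0 powr (\<beta> - 1) = 0\<close>.\<close>
    then have "x t = x0 * t powr (\<beta> - 1) + abel_integral \<beta> F t / Gamma \<beta>" if "0 \<le> t" for t
      using that x_eq[of t] by (cases "t = 0") (auto simp: x_def)
    then show "has_RL_derivative \<beta> x (f t (x t)) t"
      using RL_derivative_of_abel[OF beta F_meas F_cont F_loc xm _ t, of x0] F_pos[OF t] by simp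
  next
    have "y 0 = x0" by (subst y) (simp add: volterra_def)
    moreover have "isCont y 0" using yc by (simp add: continuous_on_eq_continuous_at)
    ultimately have "(y \<longlongrightarrow> x0) (at_right 0)"
      unfolding isCont_def by (metis tendsto_within_subset subset_UNIV)
    moreover have "\<forall>\<^sub>F t in at_right 0. y t = t powr (1 - \<beta>) * x t"
      using eventually_at_right_less[of "0::real"]
      by eventually_elim (simp add: x_def mult.assoc[symmetric] flip: powr_add)
    ultimately show "((\<lambda>t. t powr (1 - \<beta>) * x t) \<longlongrightarrow> x0) (at_right 0)"
      by (rule Lim_transform_eventually)
  qed
  have weighted: "C_weighted (1 - \<beta>) x"
    unfolding C_weighted_def
  proof (intro conjI exI[of _ y] allI impI x_cont)
    show "continuous_on {0..} y" using yc by (rule continuous_on_subset) simp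
    show "y t = t powr (1 - \<beta>) * x t" if "0 < t" for t
      using that by (simp add: x_def mult.assoc[symmetric] flip: powr_add)
  qed
  obtain K where K: "0 \<le> K" "\<And>t. 1 \<le> t \<Longrightarrow> t powr \<gamma> * \<bar>l t\<bar> \<le> K" "\<And>t. 1 \<le> t \<Longrightarrow> t powr \<gamma> * \<bar>l1 t\<bar> \<le> K"
    using assms(12) by auto
  have l_le: "t powr \<beta> * \<bar>u\<bar> \<le> K * t powr (\<beta> - \<gamma>)" if "1 \<le> t" "t powr \<gamma> * \<bar>u\<bar> \<le> K" for t u :: real
  proof -
    have "t powr (\<beta> - \<gamma>) * (t powr \<gamma> * \<bar>u\<bar>) \<le> t powr (\<beta> - \<gamma>) * K"
      using that(2) by (intro mult_left_mono) auto
    moreover have "t powr (\<beta> - \<gamma>) * (t powr \<gamma> * \<bar>u\<bar>) = t powr \<beta> * \<bar>u\<bar>"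
      using that(1) by (simp add: mult.assoc[symmetric] flip: powr_add)
    ultimately show ?thesis by (simp only: mult.commute)
  qed
  have decay: "((\<lambda>t. C * t powr (\<beta> - \<gamma>)) \<longlongrightarrow> 0) at_top" for C
  proof -
    have "((\<lambda>t. C * t powr (\<beta> - \<gamma>)) \<longlongrightarrow> C * 0) at_top"
      using bg by (intro tendsto_mult tendsto_const tendsto_neg_powr filterlim_ident) auto
    then show ?thesis by simp
  qed
  \<comment> \<open>The constant is \<open>2 * (\<bar>b\<bar> + 1)\<close> for the two functions \<open>k\<close>, \<open>k1\<close> plus \<open>1\<close> from \<open>\<bar>pow\<mu> x\<bar> \<le> 1 + \<bar>x\<bar>\<close>.\<close>
  have small: "\<exists>T. \<forall>s\<ge>T. \<bar>F s\<bar> \<le> (2 * \<bar>b\<bar> + 3 + e * \<bar>x s\<bar>) * s powr (- \<beta>)" if e: "0 < e" for e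
  proof -
    have "\<forall>\<^sub>F s in at_top. 2 * K * s powr (\<beta> - \<gamma>) < min e 1"
      using order_tendstoD(2)[OF decay, of "min e 1" "2 * K"] e by simp
    moreover have "\<forall>\<^sub>F s in at_top. \<bar>s powr \<beta> * k s\<bar> < \<bar>b\<bar> + 1"
      using order_tendstoD(2)[OF tendsto_rabs[OF assms(17)], of "\<bar>b\<bar> + 1"] by simp
    moreover have "\<forall>\<^sub>F s in at_top. \<bar>s powr \<beta> * k1 s\<bar> < \<bar>b\<bar> + 1"
      using order_tendstoD(2)[OF tendsto_rabs[OF assms(18)], of "\<bar>b\<bar> + 1"] by simp
    ultimately have "\<forall>\<^sub>F s in at_top. \<bar>F s\<bar> \<le> (2 * \<bar>b\<bar> + 3 + e * \<bar>x s\<bar>) * s powr (- \<beta>)"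
      using eventually_ge_at_top[of 1]
    proof eventually_elim
      case (elim s)
      have s: "0 < s" using elim by simp
      have q: "s powr \<beta> * (\<bar>l s\<bar> + \<bar>l1 s\<bar>) \<le> 2 * K * s powr (\<beta> - \<gamma>)"
        using l_le[OF elim(4) K(2)[OF elim(4)]] l_le[OF elim(4) K(3)[OF elim(4)]] by (simp add: distrib_left)
      have "\<bar>pow\<mu> (x s)\<bar> \<le> 1 + \<bar>x s\<bar>"
        using real_power_fun_abs_le[OF P mu, of 1 "x s"] by simp
      then have "s powr \<beta> * (\<bar>l s\<bar> + \<bar>l1 s\<bar>) * \<bar>pow\<mu> (x s)\<bar> \<le> 2 * K * s powr (\<beta> - \<gamma>) * (1 + \<bar>x s\<bar>)"
        by (rule mult_mono[OF q]) (use K in auto)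
      also have "\<dots> = 2 * K * s powr (\<beta> - \<gamma>) + 2 * K * s powr (\<beta> - \<gamma>) * \<bar>x s\<bar>"
        by (simp add: distrib_left)
      also have "\<dots> \<le> 1 + e * \<bar>x s\<bar>"
        using elim(1) by (intro add_mono[OF _ mult_right_mono]) auto
      finally have L: "s powr \<beta> * (\<bar>l s\<bar> + \<bar>l1 s\<bar>) * \<bar>pow\<mu> (x s)\<bar> \<le> 1 + e * \<bar>x s\<bar>" .
      have M: "s powr \<beta> * (\<bar>k s\<bar> + \<bar>k1 s\<bar>) \<le> 2 * \<bar>b\<bar> + 2"
        using elim(2,3) by (simp add: abs_mult distrib_left)
      have "s powr \<beta> * \<bar>F s\<bar> \<le> s powr \<beta> * ((\<bar>l s\<bar> + \<bar>l1 s\<bar>) * \<bar>pow\<mu> (x s)\<bar> + (\<bar>k s\<bar> + \<bar>k1 s\<bar>))"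
        unfolding F_pos[OF s] by (intro mult_left_mono f_abs s) auto
      also have "\<dots> = s powr \<beta> * (\<bar>l s\<bar> + \<bar>l1 s\<bar>) * \<bar>pow\<mu> (x s)\<bar> + s powr \<beta> * (\<bar>k s\<bar> + \<bar>k1 s\<bar>)"
        by (simp only: ring_distribs mult.assoc)
      also have "\<dots> \<le> (1 + e * \<bar>x s\<bar>) + (2 * \<bar>b\<bar> + 2)"
        using L M by (rule add_mono)
      also have "\<dots> = 2 * \<bar>b\<bar> + 3 + e * \<bar>x s\<bar>" by simp
      finally have "s powr \<beta> * \<bar>F s\<bar> \<le> 2 * \<bar>b\<bar> + 3 + e * \<bar>x s\<bar>" .
      then have "s powr (- \<beta>) * (s powr \<beta> * \<bar>F s\<bar>) \<le> s powr (- \<beta>) * (2 * \<bar>b\<bar> + 3 + e * \<bar>x s\<bar>)"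
        by (intro mult_left_mono) auto
      moreover have "s powr (- \<beta>) * (s powr \<beta> * \<bar>F s\<bar>) = \<bar>F s\<bar>"
        using s by (simp add: mult.assoc[symmetric] flip: powr_add)
      ultimately show ?case by (simp only: mult.commute)
    qed
    then show ?thesis by (simp only: eventually_at_top_linorder)
  qed
  obtain X where X: "\<And>t. 1 \<le> t \<Longrightarrow> \<bar>x t\<bar> \<le> X"
    using abel_solution_bounded[OF beta F_meas F_int x_cont x_eq small] by blast
  have negligible: "((\<lambda>t. t powr \<beta> * (g t * pow\<mu> (x t))) \<longlongrightarrow> 0) at_top"
    if g: "\<And>t. 1 \<le> t \<Longrightarrow> t powr \<gamma> * \<bar>g t\<bar> \<le> K" for g :: "real \<Rightarrow> real"
  proof (rule Lim_null_comparison[OF _ decay[of "K * (1 + X)"]])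
    show "\<forall>\<^sub>F t in at_top. norm (t powr \<beta> * (g t * pow\<mu> (x t))) \<le> K * (1 + X) * t powr (\<beta> - \<gamma>)"
      using eventually_ge_at_top[of 1]
    proof eventually_elim
      case (elim t)
      have "\<bar>pow\<mu> (x t)\<bar> \<le> 1 + X"
        using real_power_fun_abs_le[OF P mu, of 1 "x t"] X[OF elim] by simp
      then have "(t powr \<beta> * \<bar>g t\<bar>) * \<bar>pow\<mu> (x t)\<bar> \<le> (K * t powr (\<beta> - \<gamma>)) * (1 + X)"
        by (rule mult_mono[OF l_le[OF elim g[OF elim]]]) (use K in auto)
      then show ?case by (simp add: abs_mult mult_ac)
    qed
  qed
  have F_lim: "((\<lambda>t. t powr \<beta> * F t) \<longlongrightarrow> b) at_top"
  proof (rule tendsto_sandwich)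
    show "((\<lambda>t. t powr \<beta> * (l1 t * pow\<mu> (x t)) + t powr \<beta> * k1 t) \<longlongrightarrow> b) at_top"
      using tendsto_add[OF negligible[OF K(3)] assms(18)] by simp
    show "((\<lambda>t. t powr \<beta> * (l t * pow\<mu> (x t)) + t powr \<beta> * k t) \<longlongrightarrow> b) at_top"
      using tendsto_add[OF negligible[OF K(2)] assms(17)] by simp
    show "\<forall>\<^sub>F t in at_top. t powr \<beta> * (l1 t * pow\<mu> (x t)) + t powr \<beta> * k1 t \<le> t powr \<beta> * F t"
      using eventually_gt_at_top[of 0]
      by eventually_elim (simp add: F_pos sandwich mult_left_mono flip: distrib_left)
    show "\<forall>\<^sub>F t in at_top. t powr \<beta> * F t \<le> t powr \<beta> * (l t * pow\<mu> (x t)) + t powr \<beta> * k t"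
      using eventually_gt_at_top[of 0]
      by eventually_elim (simp add: F_pos sandwich mult_left_mono flip: distrib_left)
  qed
  have limit_eq: "x0 * 0 + b * (Gamma \<beta> * Gamma (1 - \<beta>)) / Gamma \<beta> = b * pi / (Gamma \<beta> * sin (\<beta> * pi))"
    using Gamma_reflection_real[OF beta] by (simp add: mult.commute)
  have "((\<lambda>t. x0 * t powr (\<beta> - 1) + abel_integral \<beta> F t / Gamma \<beta>) \<longlongrightarrow>
      x0 * 0 + b * (Gamma \<beta> * Gamma (1 - \<beta>)) / Gamma \<beta>) at_top"
    using beta by (intro tendsto_intros tendsto_neg_powr filterlim_ident abel_tendsto_at_top F_meas F_int F_lim
        less_imp_neq[OF G, symmetric]) auto
  moreover have "\<forall>\<^sub>F t in at_top. x0 * t powr (\<beta> - 1) + abel_integral \<beta> F t / Gamma \<beta> = x t"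
    using eventually_gt_at_top[of 0] by eventually_elim (simp add: x_eq)
  ultimately have "(x \<longlongrightarrow> b * pi / (Gamma \<beta> * sin (\<beta> * pi))) at_top"
    unfolding limit_eq by (rule Lim_transform_eventually)
  with solution weighted show ?thesis by blast
qed

end
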